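(* Let $m\geq 1$ be an integer and let $h:{}^m\mathbb{A}\to{}^m\mathbb{A}$ be a homeomorphism. Then there is a pairwise disjoint sequence of basic clopen boxes $U_n=\prod_{j\in m} I^j_n$ ($n\in\omega$), each $I^j_n$ a clopen interval of $\mathbb{A}$, such that $\bigcup_n U_n$ is dense in ${}^m\mathbb{A}$ and for each $n$ we have $h\restriction U_n=\sigma\circ(h^0\times\cdots\times h^{m-1})$, where each $h^j:I^j_n\to\mathbb{A}$ is a strictly monotone homeomorphism onto a clopen interval of $\mathbb{A}$, and $\sigma:{}^m\mathbb{A}\to{}^m\mathbb{A}$ is a permutation of the coordinates (i.e. there is a bijection $\tau$ of $m=\{0,\dots,m-1\}$ with $\sigma(y)(\tau(j))=y(j)$ for all $y$ and $j$).
   Context: Let $\mathbb{A}_0=\,]0,1]\times\{0\}$, $\mathbb{A}_1=[0,1[\,\times\{1\}$ and $\mathbb{A}=\mathbb{A}_0\cup\mathbb{A}_1$, ordered lexicographically: $\langle a,r\rangle\prec\langle b,s\rangle$ iff $a<b$, or $a=b$ and $r<s$; $\mathbb{A}$ (the double arrow space) carries the order topology. ${}^m\mathbb{A}$ is the $m$-th power with the product topology, elements viewed as functions $m=\{0,\dots,m-1\}\to\mathbb{A}$. A clopen interval is a nonempty convex subset of $\mathbb{A}$ that is clopen. A partial function $f:\mathbb{A}\to\mathbb{A}$ is strictly monotone if it is strictly increasing or strictly decreasing. $h^0\times\cdots\times h^{m-1}$ is the product map $x\mapsto (h^0(x(0)),\dots,h^{m-1}(x(m-1)))$. *)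

theory Defs
  imports "HOL-Analysis.Analysis"
begin

definition DA :: "(real \<times> nat) set" where
  "DA = ({a. 0 < a \<and> a \<le> 1} \<times> {0}) \<union> ({a. 0 \<le> a \<and> a < 1} \<times> {1})"

definition lexless :: "real \<times> nat \<Rightarrow> real \<times> nat \<Rightarrow> bool" where
  "lexless p q \<longleftrightarrow> fst p < fst q \<or> (fst p = fst q \<and> snd p < snd q)"

definition DA_top :: "(real \<times> nat) topology" where
  "DA_top = topology_generated_by
     ((\<lambda>c. {x \<in> DA. lexless x c}) ` DA \<union> (\<lambda>c. {x \<in> DA. lexless c x}) ` DA)"

definition DA_pow :: "nat \<Rightarrow> (nat \<Rightarrow> real \<times> nat) topology" where
  "DA_pow m = product_topology (\<lambda>_. DA_top) {..<m}"

definition convex_DA :: "(real \<times> nat) set \<Rightarrow> bool" where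
  "convex_DA S \<longleftrightarrow> S \<subseteq> DA \<and>
     (\<forall>x\<in>S. \<forall>z\<in>S. \<forall>y\<in>DA. lexless x y \<and> lexless y z \<longrightarrow> y \<in> S)"

definition clopen_interval :: "(real \<times> nat) set \<Rightarrow> bool" where
  "clopen_interval S \<longleftrightarrow> S \<noteq> {} \<and> convex_DA S \<and> openin DA_top S \<and> closedin DA_top S"

definition strictly_monotone_on :: "(real \<times> nat) set \<Rightarrow> (real \<times> nat \<Rightarrow> real \<times> nat) \<Rightarrow> bool" where
  "strictly_monotone_on I f \<longleftrightarrow>
     (\<forall>x\<in>I. \<forall>y\<in>I. lexless x y \<longrightarrow> lexless (f x) (f y)) \<or>
     (\<forall>x\<in>I. \<forall>y\<in>I. lexless x y \<longrightarrow> lexless (f y) (f x))"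

end

theory Submission
  imports Defs
begin

text \<open>
  Away from countably many real values of each coordinate, the real parts of the coordinates of \<open>h\<close>
  do not distinguish \<open>(a, 0)\<close> from \<open>(a, 1)\<close>. Over a point \<open>a\<close> avoiding these values, \<open>h\<close> therefore maps
  the fibre of the projection to \<open>\<real>\<^sup>m\<close> bijectively onto another fibre, and so induces a permutation of
  \<open>{0, 1}\<^sup>m\<close>. By Baire's theorem, on a set dense in some box this permutation is constant and the
  continuity of \<open>h\<close> at the fibres is uniform: the orthant of \<open>b - a\<close> then determines the orthant of
  \<open>h b - h a\<close>. Density forces each coordinate of \<open>h\<close> to depend, strictly monotonically, on the sign in
  a single input coordinate; this passes to the closure, and injectivity makes the assignment of
  coordinates bijective. Shrinking the box makes the images intervals, and countably many disjoint
  such boxes are chosen along a countable \<open>\<pi>\<close>-base.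
\<close>

subsection \<open>The topology of the double arrow space\<close>

lemma lexless_simp [simp]: "lexless (a, r) (b, s) \<longleftrightarrow> a < b \<or> a = b \<and> r < s"
  by (simp add: lexless_def)

lemma lexless_trans: "lexless x y \<Longrightarrow> lexless y z \<Longrightarrow> lexless x z"
  by (auto simp: lexless_def)

lemma lexless_irrefl [simp]: "\<not> lexless x x"
  by (auto simp: lexless_def)

lemma lexless_asym: "lexless x y \<Longrightarrow> \<not> lexless y x"
  by (auto simp: lexless_def)

lemma lexless_linear: "lexless x y \<or> x = y \<or> lexless y x"
  by (auto simp: lexless_def prod_eq_iff)

lemma DA_iff: "(a, r) \<in> DA \<longleftrightarrow> r = 0 \<and> 0 < a \<and> a \<le> 1 \<or> r = 1 \<and> 0 \<le> a \<and> a < 1"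
  by (auto simp: DA_def)

lemma topspace_DA_top [simp]: "topspace DA_top = DA"
proof -
  have 0: "(0, 1) \<in> DA" and 1: "(1, 0) \<in> DA" by (auto simp: DA_iff)
  have "x \<in> \<Union> ((\<lambda>c. {x \<in> DA. lexless x c}) ` DA \<union> (\<lambda>c. {x \<in> DA. lexless c x}) ` DA)"
    if "x \<in> DA" for x
  proof (cases "x = (0, 1)")
    case True
    with 1 that show ?thesis by force
  next
    case False
    with that have "lexless (0, 1) x"
      by (cases x) (auto simp: DA_iff)
    with 0 that show ?thesis by blast
  qed
  then have "DA \<subseteq> \<Union> ((\<lambda>c. {x \<in> DA. lexless x c}) ` DA \<union> (\<lambda>c. {x \<in> DA. lexless c x}) ` DA)"
    by (rule subsetI)
  moreover have "\<Union> ((\<lambda>c. {x \<in> DA. lexless x c}) ` DA \<union> (\<lambda>c. {x \<in> DA. lexless c x}) ` DA) \<subseteq> DA"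
    by blast
  ultimately show ?thesis
    unfolding DA_top_def topology_generated_by_topspace by (rule equalityI[rotated])
qed

lemma openin_DA_less: "c \<in> DA \<Longrightarrow> openin DA_top {x \<in> DA. lexless x c}"
  unfolding DA_top_def by (rule topology_generated_by_Basis) auto

lemma openin_DA_greater: "c \<in> DA \<Longrightarrow> openin DA_top {x \<in> DA. lexless c x}"
  unfolding DA_top_def by (rule topology_generated_by_Basis) auto

text \<open>The sets \<open>below c\<close> and \<open>above c\<close> are the two halves of the cut between \<open>(c, 0)\<close> and \<open>(c, 1)\<close>;
  all real \<open>c\<close> are allowed.\<close>

definition below :: "real \<Rightarrow> (real \<times> nat) set" where
  "below c = {x \<in> DA. lexless x (c, 1)}"

definition above :: "real \<Rightarrow> (real \<times> nat) set" where
  "above c = {x \<in> DA. lexless (c, 0) x}"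

lemma above_eq: "above c = DA - below c"
  by (auto simp: above_def below_def DA_def)

text \<open>The bound \<open>(c, 1)\<close> belongs to \<open>DA\<close> only for
  \<open>0 \<le> c < 1\<close>; for other \<open>c\<close> the set is empty or all of
  \<open>DA\<close>.\<close>

lemma openin_below: "openin DA_top (below c)"
proof -
  consider "c < 0" | "0 \<le> c \<and> c < 1" | "c \<ge> 1" by linarith
  then show ?thesis
  proof cases
    case 1
    then have "below c = {}" by (auto simp: below_def DA_def)
    then show ?thesis by simp
  next
    case 2
    then show ?thesis unfolding below_def by (intro openin_DA_less) (auto simp: DA_iff)
  next
    case 3
    then have "below c = DA" by (auto simp: below_def DA_def)
    then show ?thesis by (metis openin_topspace topspace_DA_top)
  qed
qed

lemma openin_above: "openin DA_top (above c)"
proof -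
  consider "c \<le> 0" | "0 < c \<and> c \<le> 1" | "c > 1" by linarith
  then show ?thesis
  proof cases
    case 1
    then have "above c = DA" by (auto simp: above_def DA_def)
    then show ?thesis by (metis openin_topspace topspace_DA_top)
  next
    case 2
    then show ?thesis unfolding above_def by (intro openin_DA_greater) (auto simp: DA_iff)
  next
    case 3
    then have "above c = {}" by (auto simp: above_def DA_def)
    then show ?thesis by simp
  qed
qed

lemma closedin_below: "closedin DA_top (below c)"
proof -
  have "DA - below c = above c" by (simp add: above_eq)
  then show ?thesis using openin_above by (simp add: closedin_def) (auto simp: below_def)
qed

lemma closedin_above: "closedin DA_top (above c)"
proof -
  have "DA - above c = below c" by (auto simp: above_eq below_def)
  then show ?thesis using openin_below by (simp add: closedin_def) (auto simp: above_def)
qed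

lemma below_less_above: "x \<in> below c \<Longrightarrow> y \<in> above c \<Longrightarrow> lexless x y"
  by (cases x; cases y) (auto simp: below_def above_def)

text \<open>A common real part is itself a cut between the two points; otherwise the midpoint of the
  real parts is one.\<close>

lemma DA_cut:
  assumes "x \<in> DA" "y \<in> DA" "lexless x y"
  obtains c where "x \<in> below c" "y \<in> above c"
proof (cases "fst x = fst y")
  case True
  then have "x \<in> below (fst x)" "y \<in> above (fst x)"
    using assms by (auto simp: below_def above_def DA_def)
  then show ?thesis using that by blast
next
  case False
  then have "x \<in> below ((fst x + fst y) / 2)" "y \<in> above ((fst x + fst y) / 2)"
    using assms by (auto simp: below_def above_def lexless_def field_simps)
  then show ?thesis using that by blast
qed

lemma Hausdorff_DA_top: "Hausdorff_space DA_top"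
  unfolding Hausdorff_space_def
proof (intro allI impI)
  fix x y assume "x \<in> topspace DA_top \<and> y \<in> topspace DA_top \<and> x \<noteq> y"
  then have xy: "x \<in> DA" "y \<in> DA" and "lexless x y \<or> lexless y x"
    using lexless_linear[of x y] by auto
  moreover have disj: "disjnt (below c) (above c)" for c
    by (auto simp: above_eq disjnt_def)
  ultimately show "\<exists>U V. openin DA_top U \<and> openin DA_top V \<and> x \<in> U \<and> y \<in> V \<and> disjnt U V"
    by (meson DA_cut disjnt_sym openin_above openin_below)
qed

text \<open>By Alexander's subbase theorem it is enough to treat covers by open rays. The supremum
  of the ends of the lower rays leads to a lower ray with end \<open>c\<close> and an upper ray with
  end \<open>d\<close> such that \<open>lexless d c\<close>; these two cover
  \<open>DA\<close>.\<close>

lemma compact_DA_top: "compact_space DA_top"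
proof -
  define B where "B = (\<lambda>c. {x \<in> DA. lexless x c}) ` DA \<union> (\<lambda>c. {x \<in> DA. lexless c x}) ` DA"
  \<comment> \<open>The form in which \<open>Alexander_subbase\<close> presents a topology; it is
    identified with \<open>DA_top\<close> below.\<close>
  define T where "T = topology (arbitrary union_of (finite intersection_of (\<lambda>x. x \<in> B) relative_to \<Union>B))"
  have UB: "\<Union>B = DA"
    using topspace_DA_top by (simp add: DA_top_def B_def)
  have B_open: "openin T S" if "S \<in> B" for S
  proof -
    have "(finite intersection_of (\<lambda>x. x \<in> B)) S"
      using that by (simp add: finite_intersection_of_inc)
    then have "(finite intersection_of (\<lambda>x. x \<in> B) relative_to \<Union>B) S"
      using that unfolding relative_to_def by (intro exI[of _ S]) auto
    then show ?thesis
      unfolding T_def openin_subbase by (rule arbitrary_union_of_inc)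
  qed
  have "openin T S" if "generate_topology_on B S" for S
    by (rule generate_topology_on_coarsest[OF istopology_openin B_open that])
  moreover have "openin DA_top S" if "openin T S" for S
  proof (rule minimal_topology_subbase)
    show "openin DA_top S" if "S \<in> B" for S
      using that openin_DA_less openin_DA_greater by (auto simp: B_def)
    show "openin DA_top (\<Union>B)"
      by (metis UB openin_topspace topspace_DA_top)
    show "openin (topology (arbitrary union_of (finite intersection_of (\<lambda>x. x \<in> B) relative_to \<Union>B))) S"
      using that by (simp add: T_def)
  qed
  moreover have "generate_topology_on B S" if "openin DA_top S" for S
    using that unfolding DA_top_def B_def by (rule openin_topology_generated_by)
  ultimately have T: "T = DA_top"
    unfolding topology_eq by blast
  show ?thesis
  proof (rule Alexander_subbase)
    show "topology (arbitrary union_of (finite intersection_of (\<lambda>x. x \<in> B) relative_to \<Union>B)) = DA_top"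
      using T by (simp add: T_def)
  next
    fix C assume CB: "C \<subseteq> B" and "\<Union>C = topspace DA_top"
    then have UC: "\<Union>C = DA" by simp
    define S where "S = {c \<in> DA. {x \<in> DA. lexless x c} \<in> C}"
    have cov: "(\<exists>c\<in>S. lexless p c) \<or> (\<exists>d\<in>DA. {x \<in> DA. lexless d x} \<in> C \<and> lexless d p)"
      if "p \<in> DA" for p
    proof -
      have "p \<in> \<Union>C" using UC that by simp
      then obtain O1 where "O1 \<in> C" "p \<in> O1" by (rule UnionE)
      then have "O1 \<in> B" using CB by blast
      then consider c where "c \<in> DA" "O1 = {x \<in> DA. lexless x c}"
        | c where "c \<in> DA" "O1 = {x \<in> DA. lexless c x}"
        unfolding B_def by blast
      then show ?thesis
        using \<open>O1 \<in> C\<close> \<open>p \<in> O1\<close> by cases (auto simp: S_def)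
    qed
    have "\<exists>c\<in>S. \<exists>d\<in>DA. {x \<in> DA. lexless d x} \<in> C \<and> lexless d c"
    proof -
      have "(0, 1) \<in> DA" by (simp add: DA_iff)
      moreover have "\<not> lexless d (0, 1)" if "d \<in> DA" for d
        using that by (auto simp: DA_def)
      ultimately obtain c0 where c0: "c0 \<in> S" "lexless (0, 1) c0" using cov by blast
      then have c0p: "fst c0 > 0" by (auto simp: S_def DA_def)
      have bd: "bdd_above (fst ` S)"
        by (rule bdd_aboveI[of _ 1]) (auto simp: S_def DA_def)
      define s where "s = Sup (fst ` S)"
      have le: "fst c \<le> s" if "c \<in> S" for c
        unfolding s_def using bd that by (intro cSup_upper) auto
      have s1: "s \<le> 1"
        unfolding s_def using c0 by (intro cSup_least) (auto simp: S_def DA_def)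
      have s0: "s > 0" using le[OF c0(1)] c0p by simp
      show ?thesis
      \<comment> \<open>If \<open>(s, 1)\<close> is in \<open>S\<close>, it is the greatest element
        there; otherwise no element of \<open>S\<close> exceeds \<open>(s, 0)\<close>. Either way
        that point lies in no lower ray of \<open>C\<close>, so an upper ray must contain
        it.\<close>
      proof (cases "(s, 1) \<in> S")
        case True
        then have sDA: "(s, 1) \<in> DA" by (simp add: S_def)
        have "\<not> lexless (s, 1) c" if "c \<in> S" for c
          using le[OF that] that by (cases c) (auto simp: S_def DA_iff)
        then show ?thesis using cov[OF sDA] True by blast
      next
        case False
        have sDA: "(s, 0) \<in> DA" using s0 s1 by (simp add: DA_iff)
        have "\<not> lexless (s, 0) c" if "c \<in> S" for c
          using le[OF that] that False by (cases c) (auto simp: S_def DA_iff)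
        then obtain d where d: "d \<in> DA" "{x \<in> DA. lexless d x} \<in> C" "lexless d (s, 0)"
          using cov[OF sDA] by blast
        then have "fst d < s" by (auto simp: lexless_def)
        then obtain c where "c \<in> S" "fst d < fst c"
          unfolding s_def using less_cSupD[of "fst ` S" "fst d"] c0(1) by blast
        then show ?thesis using d by (auto simp: lexless_def)
      qed
    qed
    then obtain c d where cd: "c \<in> S" "d \<in> DA" "{x \<in> DA. lexless d x} \<in> C" "lexless d c" by blast
    define C' where "C' = {{x \<in> DA. lexless x c}, {x \<in> DA. lexless d x}}"
    have "C' \<subseteq> C" using cd by (auto simp: C'_def S_def)
    moreover have "lexless x c \<or> lexless d x" for x
      using cd(4) lexless_linear[of x c] lexless_trans[of d c x] by auto
    then have "\<Union>C' = DA"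
      by (auto simp: C'_def)
    ultimately show "\<exists>C'. finite C' \<and> C' \<subseteq> C \<and> \<Union>C' = topspace DA_top"
      by (intro exI[of _ C']) (auto simp: C'_def)
  qed
qed

section \<open>Clopen intervals and one-sided neighbourhoods\<close>

definition cint :: "real \<Rightarrow> real \<Rightarrow> (real \<times> nat) set" where
  "cint u v = above u \<inter> below v"

lemma cint_iff: "x \<in> cint u v \<longleftrightarrow> x \<in> DA \<and> lexless (u, 0) x \<and> lexless x (v, 1)"
  by (auto simp: cint_def above_def below_def)

lemma cint_subset_DA: "cint u v \<subseteq> DA"
  by (auto simp: cint_iff)

lemma openin_cint: "openin DA_top (cint u v)"
  unfolding cint_def by (intro openin_Int openin_above openin_below)

lemma closedin_cint: "closedin DA_top (cint u v)"
  unfolding cint_def by (intro closedin_Int closedin_above closedin_below)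

lemma cint_mono: "u' \<le> u \<Longrightarrow> v \<le> v' \<Longrightarrow> cint u v \<subseteq> cint u' v'"
  by (auto simp: cint_iff)

lemma mem_cint_interior: "u < a \<Longrightarrow> a < v \<Longrightarrow> (a, r) \<in> DA \<Longrightarrow> (a, r) \<in> cint u v"
  by (auto simp: cint_iff)

lemma clopen_interval_cint:
  assumes "cint u v \<noteq> {}"
  shows "clopen_interval (cint u v)"
  unfolding clopen_interval_def convex_DA_def
  using assms cint_subset_DA openin_cint closedin_cint
  by (metis cint_iff lexless_trans)

text \<open>A point of type \<open>1\<close> is approached only from the right, a point of type \<open>0\<close> only from the left.\<close>

definition nb :: "real \<times> nat \<Rightarrow> real \<Rightarrow> (real \<times> nat) set" where
  "nb x e = (if snd x = 1 then cint (fst x) (fst x + e) else cint (fst x - e) (fst x))"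

lemma nb_self: "x \<in> DA \<Longrightarrow> e > 0 \<Longrightarrow> x \<in> nb x e"
  by (cases x) (auto simp: nb_def cint_iff DA_iff)

lemma nb_mono: "e \<le> e' \<Longrightarrow> nb x e \<subseteq> nb x e'"
  by (simp add: nb_def cint_mono)

lemma openin_nb: "openin DA_top (nb x e)"
  by (simp add: nb_def openin_cint)

lemma clopen_interval_nb: "x \<in> DA \<Longrightarrow> e > 0 \<Longrightarrow> clopen_interval (nb x e)"
  unfolding nb_def using clopen_interval_cint nb_self nb_def by (metis empty_iff)

lemma nb_subset_ray:
  assumes "x \<in> DA" "c \<in> DA"
  shows "lexless x c \<Longrightarrow> \<exists>e>0. nb x e \<subseteq> {x \<in> DA. lexless x c}"
    and "lexless c x \<Longrightarrow> \<exists>e>0. nb x e \<subseteq> {x \<in> DA. lexless c x}"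
proof -
  obtain a r b s where eq: "x = (a, r)" "c = (b, s)" by (meson surj_pair)
  show "\<exists>e>0. nb x e \<subseteq> {x \<in> DA. lexless x c}" if "lexless x c"
  proof (cases "r = 0")
    case True
    then show ?thesis using that assms
      by (intro exI[of _ 1]) (auto simp: eq nb_def cint_iff DA_iff)
  next
    case False
    then show ?thesis using that assms
      by (intro exI[of _ "(b - a) / 2"]) (auto simp: eq nb_def cint_iff DA_iff field_simps)
  qed
  show "\<exists>e>0. nb x e \<subseteq> {x \<in> DA. lexless c x}" if "lexless c x"
  proof (cases "r = 0")
    case True
    then show ?thesis using that assms
      by (intro exI[of _ "(a - b) / 2"]) (auto simp: eq nb_def cint_iff DA_iff field_simps)
  next
    case False
    then show ?thesis using that assms
      by (intro exI[of _ 1]) (auto simp: eq nb_def cint_iff DA_iff)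
  qed
qed

text \<open>With \<open>openin_nb\<close> and \<open>nb_self\<close> this makes the sets
  \<open>nb x e\<close> a neighbourhood base at \<open>x\<close>. The induction follows the
  generation of the topology from rays.\<close>

lemma openin_DA_top_nb:
  assumes "openin DA_top S" "x \<in> S"
  shows "\<exists>e>0. nb x e \<subseteq> S"
proof -
  have "generate_topology_on ((\<lambda>c. {x \<in> DA. lexless x c}) ` DA \<union> (\<lambda>c. {x \<in> DA. lexless c x}) ` DA) S"
    using assms(1) unfolding DA_top_def by (rule openin_topology_generated_by)
  then have "\<forall>x\<in>S. \<exists>e>0. nb x e \<subseteq> S"
  proof induction
    case (Int a b)
    show ?case
    proof
      fix x assume "x \<in> a \<inter> b"
      then obtain e1 e2 where "e1 > 0" "nb x e1 \<subseteq> a" "e2 > 0" "nb x e2 \<subseteq> b"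
        using Int.IH by blast
      then show "\<exists>e>0. nb x e \<subseteq> a \<inter> b"
        using nb_mono[of "min e1 e2" e1 x] nb_mono[of "min e1 e2" e2 x]
        by (intro exI[of _ "min e1 e2"]) auto
    qed
  next
    case (UN K)
    then show ?case by (meson UnionE Union_upper order_trans)
  next
    case (Basis s)
    then show ?case using nb_subset_ray by fastforce
  qed simp
  then show ?thesis using assms(2) by blast
qed

subsection \<open>Fibres of the projection to the reals\<close>

lemma topspace_DA_pow [simp]: "topspace (DA_pow m) = PiE {..<m} (\<lambda>_. DA)"
  by (simp add: DA_pow_def)

lemma compact_DA_pow: "compact_space (DA_pow m)"
  by (simp add: DA_pow_def compact_space_product_topology compact_DA_top)

lemma Hausdorff_DA_pow: "Hausdorff_space (DA_pow m)"
  by (simp add: DA_pow_def Hausdorff_space_product_topology Hausdorff_DA_top)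

lemma openin_box:
  assumes "\<And>i. i < m \<Longrightarrow> openin DA_top (S i)"
  shows "openin (DA_pow m) (PiE {..<m} S)"
  using assms by (auto simp: DA_pow_def openin_PiE_gen)

lemma closedin_box:
  assumes "\<And>i. i < m \<Longrightarrow> closedin DA_top (S i)"
  shows "closedin (DA_pow m) (PiE {..<m} S)"
  using assms by (auto simp: DA_pow_def closedin_product_topology)

definition nbox :: "nat \<Rightarrow> (nat \<Rightarrow> real \<times> nat) \<Rightarrow> real \<Rightarrow> (nat \<Rightarrow> real \<times> nat) set" where
  "nbox m p e = PiE {..<m} (\<lambda>i. nb (p i) e)"

lemma openin_nbox: "openin (DA_pow m) (nbox m p e)"
  unfolding nbox_def by (intro openin_box openin_nb)

lemma nbox_self: "p \<in> PiE {..<m} (\<lambda>_. DA) \<Longrightarrow> e > 0 \<Longrightarrow> p \<in> nbox m p e"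
  by (auto simp: nbox_def PiE_iff intro: nb_self)

lemma nbox_mono: "e \<le> e' \<Longrightarrow> nbox m p e \<subseteq> nbox m p e'"
  unfolding nbox_def by (intro PiE_mono nb_mono)

lemma openin_DA_pow_nbox:
  assumes "openin (DA_pow m) W" "p \<in> W"
  shows "\<exists>e>0. nbox m p e \<subseteq> W"
proof -
  obtain U where U: "\<And>i. i < m \<Longrightarrow> openin DA_top (U i)" "p \<in> PiE {..<m} U" "PiE {..<m} U \<subseteq> W"
    using assms unfolding DA_pow_def openin_product_topology_alt by (meson lessThan_iff)
  have "\<exists>e>0. nb (p i) e \<subseteq> U i" if "i < m" for i
    using U that by (intro openin_DA_top_nb) auto
  then obtain e where e: "\<And>i. i < m \<Longrightarrow> e i > 0" "\<And>i. i < m \<Longrightarrow> nb (p i) (e i) \<subseteq> U i"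
    by metis
  \<comment> \<open>Inserting \<open>1\<close> keeps the minimum defined when
    \<open>m = 0\<close>.\<close>
  define d where "d = Min (insert 1 (e ` {..<m}))"
  have "d > 0" using e by (auto simp: d_def)
  moreover have "d \<le> e i" if "i < m" for i
    unfolding d_def using that by (intro Min_le) auto
  then have "nb (p i) d \<subseteq> U i" if "i < m" for i
    using nb_mono[of d "e i" "p i"] e(2)[OF that] that by (meson order_trans)
  then have "nbox m p d \<subseteq> PiE {..<m} U"
    unfolding nbox_def by (intro PiE_mono) auto
  ultimately show ?thesis using U(3) by blast
qed

text \<open>The interval \<open>nb q e\<close> begins and ends at cuts, which sit at
  \<open>fst q\<close> and at one of \<open>fst q + e\<close> and \<open>fst q - e\<close>; only
  there can it separate the twins \<open>(a, 0)\<close> and \<open>(a, 1)\<close>.\<close>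

lemma nb_swap:
  assumes "(a, 0) \<in> DA" "(a, 1) \<in> DA" "a \<noteq> fst q" "a \<noteq> fst q + e" "a \<noteq> fst q - e"
  shows "(a, 0) \<in> nb q e \<longleftrightarrow> (a, 1) \<in> nb q e"
  using assms by (auto simp: nb_def cint_iff)

text \<open>By compactness finitely many boxes \<open>nbox m p (e p)\<close>, each inside
  \<open>C\<close> or inside its complement, cover the power. Twins that \<open>C\<close> separates
  must be separated by a box, hence lie at one of its finitely many end points.\<close>

lemma finite_clopen_jumps:
  assumes "openin (DA_pow m) C" "closedin (DA_pow m) C"
  shows "finite {a. \<exists>i<m. \<exists>y\<in>PiE {..<m} (\<lambda>_. DA). (a, 0) \<in> DA \<and> (a, 1) \<in> DA \<and>
           (y(i := (a, 0)) \<in> C) \<noteq> (y(i := (a, 1)) \<in> C)}" (is "finite ?J")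
proof -
  let ?Z = "PiE {..<m} (\<lambda>_. DA)"
  have op: "openin (DA_pow m) (?Z - C)"
    using assms(2) by (auto simp: closedin_def)
  have "\<exists>e>0. nbox m p e \<subseteq> C \<or> nbox m p e \<subseteq> ?Z - C" if "p \<in> ?Z" for p
    using openin_DA_pow_nbox[OF assms(1), of p] openin_DA_pow_nbox[OF op, of p] that by blast
  then obtain e where e: "\<And>p. p \<in> ?Z \<Longrightarrow> e p > 0"
      "\<And>p. p \<in> ?Z \<Longrightarrow> nbox m p (e p) \<subseteq> C \<or> nbox m p (e p) \<subseteq> ?Z - C"
    by metis
  have "\<forall>U\<in>(\<lambda>p. nbox m p (e p)) ` ?Z. openin (DA_pow m) U"
    by (auto intro: openin_nbox)
  moreover have "topspace (DA_pow m) \<subseteq> \<Union>((\<lambda>p. nbox m p (e p)) ` ?Z)"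
    using e(1) nbox_self by auto
  ultimately obtain F where F: "finite F" "F \<subseteq> (\<lambda>p. nbox m p (e p)) ` ?Z" "?Z \<subseteq> \<Union>F"
    using compact_DA_pow[of m] unfolding compact_space_alt topspace_DA_pow by (metis (no_types, lifting))
  then obtain K where K: "finite K" "K \<subseteq> ?Z" "F = (\<lambda>p. nbox m p (e p)) ` K"
    by (meson finite_subset_image)
  have "?J \<subseteq> (\<Union>p\<in>K. \<Union>i<m. {fst (p i), fst (p i) + e p, fst (p i) - e p})"
  proof
    fix a assume "a \<in> ?J"
    then obtain i y where iy: "i < m" "y \<in> ?Z" "(a, 0) \<in> DA" "(a, 1) \<in> DA"
      and ne: "(y(i := (a, 0)) \<in> C) \<noteq> (y(i := (a, 1)) \<in> C)" by blast
    have "y(i := (a, 0)) \<in> ?Z" using iy by (auto simp: PiE_iff extensional_def)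
    then obtain p where p: "p \<in> K" "y(i := (a, 0)) \<in> nbox m p (e p)"
      using F(3) K(3) by blast
    have "a \<in> {fst (p i), fst (p i) + e p, fst (p i) - e p}"
    proof (rule ccontr)
      assume "\<not> ?thesis"
      moreover have "(a, 0) \<in> nb (p i) (e p)"
        using p(2) iy(1) by (auto simp: nbox_def PiE_iff split: if_splits)
      ultimately have "(a, 1) \<in> nb (p i) (e p)"
        using nb_swap[OF iy(3,4), of "p i" "e p"] by simp
      then have "y(i := (a, 1)) \<in> nbox m p (e p)"
        using p(2) iy(1) unfolding nbox_def PiE_iff extensional_def
        by (auto split: if_splits)
      moreover have "nbox m p (e p) \<subseteq> C \<or> nbox m p (e p) \<subseteq> ?Z - C"
        using e(2) K(2) p(1) by blast
      ultimately show False using ne p(2) by blast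
    qed
    then show "a \<in> (\<Union>p\<in>K. \<Union>i<m. {fst (p i), fst (p i) + e p, fst (p i) - e p})"
      using p(1) iy(1) by blast
  qed
  moreover have "finite (\<Union>p\<in>K. \<Union>i<m. {fst (p i), fst (p i) + e p, fst (p i) - e p})"
    using K(1) by simp
  ultimately show ?thesis by (rule finite_subset)
qed

text \<open>These are the points of the fibre over \<open>a\<close>, one for each type vector
  \<open>s\<close>. The restriction makes them extensional, as \<open>PiE\<close> demands.\<close>

definition pt :: "nat \<Rightarrow> (nat \<Rightarrow> real) \<Rightarrow> (nat \<Rightarrow> nat) \<Rightarrow> nat \<Rightarrow> real \<times> nat" where
  "pt m a s = (\<lambda>i\<in>{..<m}. (a i, s i))"

locale DA_homeo =
  fixes m :: nat and h :: "(nat \<Rightarrow> real \<times> nat) \<Rightarrow> (nat \<Rightarrow> real \<times> nat)"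
  assumes m_pos: "m \<ge> 1"
    and hom: "homeomorphic_map (DA_pow m) (DA_pow m) h"
begin

abbreviation Z :: "(nat \<Rightarrow> real \<times> nat) set" where
  "Z \<equiv> PiE {..<m} (\<lambda>_. DA)"

abbreviation types :: "(nat \<Rightarrow> nat) set" where
  "types \<equiv> PiE {..<m} (\<lambda>_. {0, 1})"

lemma h_cont: "continuous_map (DA_pow m) (DA_pow m) h"
  and h_inj: "inj_on h Z"
  using hom by (auto simp: homeomorphic_eq_everything_map)

lemma h_in: "p \<in> Z \<Longrightarrow> h p \<in> Z"
  using continuous_map_image_subset_topspace[OF h_cont] by auto

lemma h_comp_in: "p \<in> Z \<Longrightarrow> j < m \<Longrightarrow> h p j \<in> DA"
  using h_in by (auto simp: PiE_iff)

lemma h_comp_cont: "j < m \<Longrightarrow> continuous_map (DA_pow m) DA_top (\<lambda>p. h p j)"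
  using h_cont continuous_map_componentwise[of "DA_pow m" "\<lambda>_. DA_top" "{..<m}" h]
  by (simp add: DA_pow_def)

lemma openin_h_vimage:
  "j < m \<Longrightarrow> openin DA_top S \<Longrightarrow> openin (DA_pow m) {p \<in> Z. h p j \<in> S}"
  using openin_continuous_map_preimage[OF h_comp_cont] by simp

lemma closedin_h_vimage:
  "j < m \<Longrightarrow> closedin DA_top S \<Longrightarrow> closedin (DA_pow m) {p \<in> Z. h p j \<in> S}"
  using closedin_continuous_map_preimage[OF h_comp_cont] by simp

section \<open>The exceptional real values\<close>

definition jumps :: "real set" where
  "jumps = {a. \<exists>i<m. \<exists>j<m. \<exists>y\<in>Z. (a, 0) \<in> DA \<and> (a, 1) \<in> DA \<and>
     fst (h (y(i := (a, 0))) j) \<noteq> fst (h (y(i := (a, 1))) j)}"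

text \<open>If exchanging twins changes the real part of coordinate \<open>j\<close>, a rational
  \<open>c\<close> lies between the two values, so the clopen preimage of \<open>below c\<close>
  separates the twins. For each of the countably many pairs of \<open>j\<close> and \<open>c\<close>
  this happens at finitely many reals only.\<close>

lemma countable_jumps: "countable jumps"
proof -
  define C where "C j c = {p \<in> Z. h p j \<in> below c}" for j c
  define J where "J j c = {a. \<exists>i<m. \<exists>y\<in>Z. (a, 0) \<in> DA \<and> (a, 1) \<in> DA \<and>
           (y(i := (a, 0)) \<in> C j c) \<noteq> (y(i := (a, 1)) \<in> C j c)}" for j c
  have "finite (J j c)" if "j < m" for j c
    unfolding J_def C_def
    using that openin_h_vimage closedin_h_vimage openin_below closedin_below
    by (intro finite_clopen_jumps) blast+
  then have "countable (\<Union>j<m. \<Union>c\<in>\<rat>. J j c)"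
    by (auto intro!: countable_UN countable_rat simp: countable_finite)
  moreover have "jumps \<subseteq> (\<Union>j<m. \<Union>c\<in>\<rat>. J j c)"
  proof
    fix a assume "a \<in> jumps"
    then obtain i j y where *: "i < m" "j < m" "y \<in> Z" "(a, 0) \<in> DA" "(a, 1) \<in> DA"
      and ne: "fst (h (y(i := (a, 0))) j) \<noteq> fst (h (y(i := (a, 1))) j)"
      by (auto simp: jumps_def)
    define p q where "p = y(i := (a, 0))" and "q = y(i := (a, 1))"
    have pq: "p \<in> Z" "q \<in> Z" using * by (auto simp: p_def q_def PiE_iff extensional_def)
    then have pq': "h p j \<in> DA" "h q j \<in> DA" using h_comp_in * by auto
    have "min (fst (h p j)) (fst (h q j)) < max (fst (h p j)) (fst (h q j))"
      using ne by (auto simp: p_def q_def)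
    then obtain c where c: "c \<in> \<rat>" "min (fst (h p j)) (fst (h q j)) < c" "c < max (fst (h p j)) (fst (h q j))"
      using Rats_dense_in_real by blast
    then have "(p \<in> C j c) \<noteq> (q \<in> C j c)"
      using pq pq' by (cases "fst (h p j) < fst (h q j)") (auto simp: C_def below_def lexless_def)
    then have "a \<in> J j c" unfolding J_def using * by (auto simp: p_def q_def)
    then show "a \<in> (\<Union>j<m. \<Union>c\<in>\<rat>. J j c)" using c * by blast
  qed
  ultimately show ?thesis by (rule countable_subset[rotated])
qed

text \<open>The values \<open>0\<close> and \<open>1\<close> are left out because only one of the
  twins exists there.\<close>

definition G :: "(nat \<Rightarrow> real) set" where
  "G = {a. \<forall>i<m. 0 < a i \<and> a i < 1 \<and> a i \<notin> jumps}"

lemma G_DA: "a \<in> G \<Longrightarrow> i < m \<Longrightarrow> (a i, 0) \<in> DA \<and> (a i, 1) \<in> DA"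
  by (auto simp: G_def DA_iff)

lemma pt_in: "a \<in> G \<Longrightarrow> s \<in> types \<Longrightarrow> pt m a s \<in> Z"
proof -
  assume a: "a \<in> G" and s: "s \<in> types"
  have "(a i, s i) \<in> DA" if "i < m" for i
  proof -
    have "s i = 0 \<or> s i = 1" using s that by (auto simp: PiE_iff)
    then show ?thesis using G_DA[OF a that] by auto
  qed
  then show ?thesis by (auto simp: pt_def)
qed

lemma fst_const:
  assumes a: "a \<in> G" and s: "s \<in> types" "s' \<in> types" and j: "j < m"
  shows "fst (h (pt m a s) j) = fst (h (pt m a s') j)"
proof -
  \<comment> \<open>Interpolates from \<open>s\<close> to \<open>s'\<close>, changing one coordinate
    at a time; since \<open>a k\<close> is not in \<open>jumps\<close>, no step moves the real
    part.\<close>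
  define r where "r k = (\<lambda>i\<in>{..<m}. if i < k then s' i else s i)" for k
  have r: "r k \<in> types" for k using s by (auto simp: r_def PiE_iff)
  have "fst (h (pt m a (r k)) j) = fst (h (pt m a s) j)" if "k \<le> m" for k
    using that
  proof (induction k)
    case 0
    have "r 0 = s" using s(1) by (auto simp: r_def PiE_iff extensional_def)
    then show ?case by simp
  next
    case (Suc k)
    define p where "p = pt m a (r k)"
    have p: "p \<in> Z" unfolding p_def using a r by (rule pt_in)
    have k: "k < m" using Suc.prems by simp
    have eq: "fst (h (p(k := (a k, 0))) j) = fst (h (p(k := (a k, 1))) j)"
      using a p j k G_DA[OF a k] unfolding G_def jumps_def by blast
    have "pt m a (r k) = p(k := (a k, s k))" "pt m a (r (Suc k)) = p(k := (a k, s' k))"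
      using k by (auto simp: p_def pt_def r_def fun_eq_iff less_Suc_eq)
    moreover have "s k \<in> {0, 1}" "s' k \<in> {0, 1}" using s k by (auto simp: PiE_iff)
    ultimately have "fst (h (pt m a (r (Suc k))) j) = fst (h (pt m a (r k)) j)"
      using eq by auto
    then show ?case using Suc by simp
  qed
  moreover have "r m = s'" using s(2) by (auto simp: r_def PiE_iff extensional_def)
  ultimately show ?thesis by (metis order_refl)
qed

text \<open>The map that \<open>h\<close> induces on real parts over \<open>G\<close>; by
  \<open>fst_const\<close> the choice of the zero type vector is immaterial.\<close>

definition hhat :: "(nat \<Rightarrow> real) \<Rightarrow> nat \<Rightarrow> real" where
  "hhat a j = fst (h (pt m a (\<lambda>i\<in>{..<m}. 0)) j)"

lemma fst_h: "a \<in> G \<Longrightarrow> s \<in> types \<Longrightarrow> j < m \<Longrightarrow> fst (h (pt m a s) j) = hhat a j"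
  unfolding hhat_def by (rule fst_const) auto

text \<open>By counting: \<open>h\<close> maps the fibre of \<open>a\<close>, which has \<open>2\<^sup>m\<close> points, injectively into a fibre.\<close>

lemma type_surj:
  assumes a: "a \<in> G" and j: "j < m" and v: "v \<in> {0, 1}"
  obtains t where "t \<in> types" "snd (h (pt m a t) j) = v"
proof -
  \<comment> \<open>The self-map of the type vectors induced over \<open>a\<close>. Images over
    \<open>a\<close> share their real parts, so injectivity of \<open>h\<close> makes \<phi>
    injective, hence onto.\<close>
  define \<phi> where "\<phi> t = (\<lambda>j\<in>{..<m}. snd (h (pt m a t) j))" for t
  have "\<phi> ` types \<subseteq> types"
  proof
    fix x assume "x \<in> \<phi> ` types"
    then obtain t where t: "t \<in> types" "x = \<phi> t" by auto
    have "snd (h (pt m a t) j) \<in> {0, 1}" if "j < m" for j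
      using h_comp_in[OF pt_in[OF a t(1)] that] by (auto simp: DA_def)
    then show "x \<in> types" by (auto simp: t \<phi>_def PiE_iff)
  qed
  moreover have "inj_on \<phi> types"
  proof (rule inj_onI)
    fix t t' assume t: "t \<in> types" "t' \<in> types" and eq: "\<phi> t = \<phi> t'"
    have "h (pt m a t) j = h (pt m a t') j" for j
    proof (cases "j < m")
      case True
      then show ?thesis using fun_cong[OF eq, of j] fst_h[OF a] t
        by (simp add: \<phi>_def prod_eq_iff)
    next
      case False
      then show ?thesis using h_in[OF pt_in[OF a t(1)]] h_in[OF pt_in[OF a t(2)]]
        by (auto simp: PiE_iff extensional_def)
    qed
    then have "h (pt m a t) = h (pt m a t')" by blast
    then have "pt m a t = pt m a t'"
      using inj_onD[OF h_inj] pt_in[OF a] t by blast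
    then have "t i = t' i" if "i < m" for i
      using that by (auto simp: pt_def fun_eq_iff split: if_splits)
    then show "t = t'" using t by (intro PiE_ext) auto
  qed
  moreover have "finite types" by (intro finite_PiE) auto
  ultimately have "\<phi> ` types = types" by (intro endo_inj_surj)
  moreover have "(\<lambda>i\<in>{..<m}. v) \<in> types" using v by auto
  ultimately have "(\<lambda>i\<in>{..<m}. v) \<in> \<phi> ` types" by (simp only:)
  then obtain t where t: "t \<in> types" "(\<lambda>i\<in>{..<m}. v) = \<phi> t" by blast
  have "snd (h (pt m a t) j) = v"
    using fun_cong[OF t(2), of j] j by (simp add: \<phi>_def)
  with t(1) show ?thesis by (rule that)
qed

end

subsection \<open>A box with uniform behaviour on a dense set\<close>

text \<open>Flipping the signs from all \<open>1\<close> to all \<open>0\<close> one coordinate at a time, \<open>P\<close> must change at some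
  coordinate \<open>k\<close>. Two points with \<open>a k < b k\<close> are then joined through a third one \<open>c\<close>, where the sign
  vectors of \<open>c - a\<close> and \<open>c - b\<close> are the two consecutive ones at \<open>k\<close>.\<close>

lemma sign_dependence_coordinate:
  fixes f :: "(nat \<Rightarrow> real) \<Rightarrow> real" and P :: "(nat \<Rightarrow> nat) \<Rightarrow> bool"
  assumes uv: "\<And>i. i < m \<Longrightarrow> u i < v i"
    and dense: "\<And>c d. (\<And>i. i < m \<Longrightarrow> u i \<le> c i \<and> c i < d i \<and> d i \<le> v i)
                  \<Longrightarrow> \<exists>a\<in>D. \<forall>i<m. c i < a i \<and> a i < d i"
    and box: "\<And>a i. a \<in> D \<Longrightarrow> i < m \<Longrightarrow> u i < a i \<and> a i < v i"
    and P: "\<And>a b s. a \<in> D \<Longrightarrow> b \<in> D \<Longrightarrow> s \<in> PiE {..<m} (\<lambda>_. {0, 1}) \<Longrightarrow>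
              (\<And>i. i < m \<Longrightarrow> a i \<noteq> b i \<and> (s i = 1 \<longleftrightarrow> a i < b i)) \<Longrightarrow>
              (if P s then f a < f b else f b < f a)"
  shows "\<exists>k<m. \<exists>e. \<forall>a\<in>D. \<forall>b\<in>D. a k < b k \<longrightarrow> (if e then f a < f b else f b < f a)"
proof -
  define r :: "nat \<Rightarrow> nat \<Rightarrow> nat" where "r k = (\<lambda>i\<in>{..<m}. if i < k then 0 else 1)" for k
  have r: "r k \<in> PiE {..<m} (\<lambda>_. {0, 1})" for k by (auto simp: r_def)
  have r1: "r k i = 1 \<longleftrightarrow> k \<le> i" if "i < m" for k i using that by (auto simp: r_def)
  \<comment> \<open>Take \<open>a\<close> below \<open>b\<close> in every coordinate: the pair
    \<open>(a, b)\<close> has sign vector \<open>r 0\<close>, the pair \<open>(b, a)\<close> has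
    \<open>r m\<close>, and \<open>f\<close> orders them oppositely.\<close>
  have "P (r 0) \<noteq> P (r m)"
  proof -
    obtain a where a: "a \<in> D" "\<forall>i<m. u i < a i \<and> a i < (u i + v i) / 2"
      using dense[of u "\<lambda>i. (u i + v i) / 2"] uv by force
    obtain b where b: "b \<in> D" "\<forall>i<m. (u i + v i) / 2 < b i \<and> b i < v i"
      using dense[of "\<lambda>i. (u i + v i) / 2" v] uv by force
    have lt: "a i < b i" if "i < m" for i using a b that by fastforce
    have "if P (r 0) then f a < f b else f b < f a"
      using lt r1 by (intro P a b r) (auto simp: less_imp_neq)
    moreover have "if P (r m) then f b < f a else f a < f b"
      using lt r1 by (intro P a b r) (force simp: less_imp_neq)
    ultimately show ?thesis by (auto split: if_splits)
  qed
  moreover have "P (r 0) = P (r k)" if "\<And>k. k < m \<Longrightarrow> P (r k) = P (r (Suc k))" "k \<le> m" for k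
    using that(2) by (induction k) (auto simp: that(1))
  ultimately obtain k where k: "k < m" "P (r k) \<noteq> P (r (Suc k))" by blast
  have "if P (r k) then f a < f b else f b < f a" if ab: "a \<in> D" "b \<in> D" "a k < b k" for a b
  proof -
    \<comment> \<open>The box for \<open>z\<close> lies under both points before \<open>k\<close>,
      between them at \<open>k\<close>, and over both after \<open>k\<close>. Hence \<open>z\<close>
      has sign vector \<open>r k\<close> relative to \<open>a\<close> and \<open>r (Suc k)\<close>
      relative to \<open>b\<close>, and \<open>f z\<close> falls between \<open>f a\<close> and
      \<open>f b\<close>.\<close>
    define c where "c i = (if i < k then u i else if i = k then a k else max (a i) (b i))" for i
    define d where "d i = (if i < k then min (a i) (b i) else if i = k then b k else v i)" for i
    have "u i \<le> c i \<and> c i < d i \<and> d i \<le> v i" if "i < m" for i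
      using box[OF ab(1) that] box[OF ab(2) that] ab(3) by (auto simp: c_def d_def)
    then obtain z where z: "z \<in> D" "\<forall>i<m. c i < z i \<and> z i < d i" using dense by metis
    have "a i \<noteq> z i \<and> (r k i = 1 \<longleftrightarrow> a i < z i)" if "i < m" for i
      using z(2) that unfolding r1[OF that] c_def d_def
      by (cases i k rule: linorder_cases) fastforce+
    then have 1: "if P (r k) then f a < f z else f z < f a"
      using ab z r by (intro P)
    have "b i \<noteq> z i \<and> (r (Suc k) i = 1 \<longleftrightarrow> b i < z i)" if "i < m" for i
      using z(2) that unfolding r1[OF that] c_def d_def
      by (cases i k rule: linorder_cases) fastforce+
    then have 2: "if P (r (Suc k)) then f b < f z else f z < f b"
      using ab z r by (intro P)
    show ?thesis using 1 2 k(2) by (auto split: if_splits)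
  qed
  then show ?thesis using k(1) by blast
qed

text \<open>Clipping to the unit interval ensures that every real strictly between \<open>u\<close>
  and \<open>v\<close> is the real part of two points of \<open>DA\<close>.\<close>

lemma nb_cint:
  assumes "x \<in> DA" "e > 0"
  obtains u v where "0 \<le> u" "u < v" "v \<le> 1" "v - u \<le> e" "cint u v \<subseteq> nb x e"
proof (cases "snd x = 1")
  case True
  then have x: "0 \<le> fst x" "fst x < 1" using assms(1) by (auto simp: DA_def)
  show ?thesis
  proof (rule that)
    show "cint (fst x) (min 1 (fst x + e)) \<subseteq> nb x e"
      using True by (simp add: nb_def cint_mono)
  qed (use x assms in auto)
next
  case False
  then have x: "0 < fst x" "fst x \<le> 1" using assms(1) by (auto simp: DA_def)
  show ?thesis
  proof (rule that)
    show "cint (max 0 (fst x - e)) (fst x) \<subseteq> nb x e"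
      using False by (simp add: nb_def cint_mono)
  qed (use x assms in auto)
qed

context DA_homeo
begin

text \<open>The clopen ray of which \<open>x\<close> is the extreme point: the least one for type
  \<open>1\<close>, the greatest one for type \<open>0\<close>.\<close>

definition side :: "real \<times> nat \<Rightarrow> (real \<times> nat) set" where
  "side x = (if snd x = 1 then above (fst x) else below (fst x))"

lemma openin_side: "openin DA_top (side x)"
  by (simp add: side_def openin_above openin_below)

lemma side_self: "x \<in> DA \<Longrightarrow> x \<in> side x"
  by (cases x) (auto simp: side_def above_def below_def DA_iff)

text \<open>\<open>B\<close> encodes the map induced on type vectors as the set of
  \<open>(s, j)\<close> whose image has type \<open>1\<close> in coordinate \<open>j\<close>;
  \<open>1 / Suc n\<close> is a radius of continuity valid on the whole fibre. Only countably many
  pairs \<open>(B, n)\<close> arise, as Baire's theorem requires.\<close>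

definition good :: "((nat \<Rightarrow> nat) \<times> nat) set \<Rightarrow> nat \<Rightarrow> (nat \<Rightarrow> real) set" where
  "good B n = {a \<in> G. \<forall>s\<in>types. \<forall>j<m.
      ((s, j) \<in> B \<longleftrightarrow> snd (h (pt m a s) j) = 1) \<and>
      (\<forall>q\<in>nbox m (pt m a s) (1 / Suc n). h q j \<in> side (h (pt m a s) j))}"

lemma finite_types: "finite types"
  by (intro finite_PiE) auto

text \<open>Continuity gives a radius for each pair \<open>(s, j)\<close>; there are finitely many
  pairs, so the minimum serves for all.\<close>

lemma good_cover:
  assumes a: "a \<in> G"
  obtains B n where "B \<subseteq> types \<times> {..<m}" "a \<in> good B n"
proof -
  define B where "B = {(s, j). s \<in> types \<and> j < m \<and> snd (h (pt m a s) j) = 1}"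
  let ?I = "types \<times> {..<m}"
  have ex: "\<exists>e>0. nbox m (pt m a s) e \<subseteq> {q \<in> Z. h q j \<in> side (h (pt m a s) j)}"
    if "s \<in> types" "j < m" for s j
    using that pt_in[OF a] side_self h_comp_in
    by (intro openin_DA_pow_nbox openin_h_vimage openin_side) auto
  define e where "e s j = (SOME e. e > 0 \<and>
      nbox m (pt m a s) e \<subseteq> {q \<in> Z. h q j \<in> side (h (pt m a s) j)})" for s j
  have e: "e s j > 0" "nbox m (pt m a s) (e s j) \<subseteq> {q \<in> Z. h q j \<in> side (h (pt m a s) j)}"
    if "s \<in> types" "j < m" for s j
    using someI_ex[OF ex[OF that]] unfolding e_def by blast+
  define d where "d = Min (insert 1 ((\<lambda>(s, j). e s j) ` ?I))"
  have fin: "finite (insert 1 ((\<lambda>(s, j). e s j) ` ?I))" using finite_types by auto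
  have "d > 0" unfolding d_def using e(1) by (subst Min_gr_iff[OF fin]) auto
  then obtain n where n: "1 / Suc n < d" by (rule nat_approx_posE)
  have "1 / Suc n \<le> e s j" if "s \<in> types" "j < m" for s j
  proof -
    have "d \<le> e s j" unfolding d_def using that by (intro Min_le fin) auto
    then show ?thesis using n by simp
  qed
  then have "\<forall>q\<in>nbox m (pt m a s) (1 / Suc n). h q j \<in> side (h (pt m a s) j)"
    if "s \<in> types" "j < m" for s j
    using that e(2) nbox_mono[of "1 / Suc n" "e s j" m "pt m a s"] by blast
  then have "a \<in> good B n"
    using a by (auto simp: good_def B_def)
  moreover have "B \<subseteq> ?I" by (auto simp: B_def)
  ultimately show ?thesis using that by blast
qed

text \<open>Since \<open>b\<close> lies on the side of \<open>a\<close> prescribed by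
  \<open>s\<close>, the entire fibre of \<open>b\<close> falls into the neighbourhood of
  \<open>pt m a s\<close>, and its image lies on one side of \<open>h (pt m a s) j\<close>. This
  gives a weak inequality of real parts.\<close>

lemma good_step:
  assumes ab: "a \<in> good B n" "b \<in> good B n" and s: "s \<in> types" and j: "j < m"
    and near: "\<And>i. i < m \<Longrightarrow> \<bar>a i - b i\<bar> < 1 / Suc n"
    and sgn: "\<And>i. i < m \<Longrightarrow> a i \<noteq> b i \<and> (s i = 1 \<longleftrightarrow> a i < b i)"
  shows "if (s, j) \<in> B then hhat a j < hhat b j else hhat b j < hhat a j"
proof -
  have G: "a \<in> G" "b \<in> G" using ab by (auto simp: good_def)
  have side: "h (pt m b t) j \<in> side (h (pt m a s) j)" if t: "t \<in> types" for t
  proof -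
    have "pt m b t i \<in> nb (pt m a s i) (1 / Suc n)" if "i < m" for i
    proof -
      have "(b i, t i) \<in> DA"
        using pt_in[OF G(2) t] that by (auto simp: pt_def PiE_iff)
      then show ?thesis
        using that near[OF that] sgn[OF that]
        by (auto simp: pt_def nb_def intro!: mem_cint_interior split: abs_split)
    qed
    then have "pt m b t \<in> nbox m (pt m a s) (1 / Suc n)"
      by (auto simp: nbox_def pt_def)
    then show ?thesis using ab(1) s j by (auto simp: good_def)
  qed
  show ?thesis
  proof (cases "(s, j) \<in> B")
    case True
    \<comment> \<open>A fibre point whose image has the opposite type cannot share the real part and
      stay on that side, so the inequality is strict.\<close>
    obtain t where t: "t \<in> types" "snd (h (pt m b t) j) = 0"
      using type_surj[OF G(2) j, of 0] by auto
    have "snd (h (pt m a s) j) = 1" using True ab(1) s j by (auto simp: good_def)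
    then show ?thesis
      using side[OF t(1)] True t(2) fst_h[OF G(1) s j] fst_h[OF G(2) t(1) j]
      by (auto simp: side_def above_def lexless_def)
  next
    case False
    obtain t where t: "t \<in> types" "snd (h (pt m b t) j) = 1"
      using type_surj[OF G(2) j, of 1] by auto
    have "snd (h (pt m a s) j) \<noteq> 1" using False ab(1) s j by (auto simp: good_def)
    then show ?thesis
      using side[OF t(1)] False t(2) fst_h[OF G(1) s j] fst_h[OF G(2) t(1) j]
      by (auto simp: side_def below_def lexless_def)
  qed
qed

section \<open>The Baire category argument\<close>

lemma closedin_hyperplane:
  assumes "i < m"
  shows "closedin (DA_pow m) {p \<in> Z. fst (p i) = e}"
proof -
  have "finite {x \<in> DA. fst x = e}"
    by (rule finite_subset[of _ "{(e, 0), (e, 1)}"]) (auto simp: DA_def)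
  then have "closedin DA_top {x \<in> DA. fst x = e}"
    using closedin_Hausdorff_finite[OF Hausdorff_DA_top] by auto
  moreover have "continuous_map (DA_pow m) DA_top (\<lambda>p. p i)"
    unfolding DA_pow_def using assms by (intro continuous_map_product_projection) auto
  ultimately have "closedin (DA_pow m) {p \<in> topspace (DA_pow m). p i \<in> {x \<in> DA. fst x = e}}"
    by (rule closedin_continuous_map_preimage[rotated])
  moreover have "{p \<in> topspace (DA_pow m). p i \<in> {x \<in> DA. fst x = e}} = {p \<in> Z. fst (p i) = e}"
    using assms by (auto simp: PiE_iff)
  ultimately show ?thesis by simp
qed

lemma interior_hyperplane:
  assumes "i < m"
  shows "DA_pow m interior_of {p \<in> Z. fst (p i) = e} = {}"
proof (rule ccontr)
  assume "\<not> ?thesis"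
  then obtain p where p: "p \<in> DA_pow m interior_of {p \<in> Z. fst (p i) = e}" by blast
  then have pZ: "p \<in> Z" using interior_of_subset by fastforce
  obtain d where d: "d > 0" "nbox m p d \<subseteq> DA_pow m interior_of {p \<in> Z. fst (p i) = e}"
    using openin_DA_pow_nbox[OF openin_interior_of p] by blast
  have "p i \<in> DA" using pZ assms by auto
  then obtain u v where uv: "0 \<le> u" "u < v" "v \<le> 1" "cint u v \<subseteq> nb (p i) d"
    using nb_cint d(1) by metis
  have *: "w = e" if w: "u < w" "w < v" for w
  proof -
    have "(w, 0) \<in> cint u v"
      using w uv by (intro mem_cint_interior) (auto simp: DA_iff)
    then have "p(i := (w, 0)) \<in> nbox m p d"
      using uv(4) nbox_self[OF pZ d(1)] assms by (auto simp: nbox_def PiE_iff extensional_def)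
    then show "w = e" using d(2) interior_of_subset by fastforce
  qed
  \<comment> \<open>Two different reals in the interval would both equal \<open>e\<close>.\<close>
  show False using *[of "(2 * u + v) / 3"] *[of "(u + 2 * v) / 3"] uv by simp
qed

text \<open>Closures of the sets \<open>T B n\<close> and hyperplanes through exceptional values are
  countably many closed sets covering \<open>W\<close>. Hyperplanes have empty interior, so by
  Baire's theorem some closure of \<open>T B n\<close> has interior points; the box is taken inside
  it.\<close>

lemma dense_good_box:
  assumes W: "openin (DA_pow m) W" "W \<noteq> {}"
  obtains B n u v where
    "\<forall>i<m. 0 \<le> u i \<and> u i < v i \<and> v i \<le> 1 \<and> v i - u i \<le> 1 / Suc n"
    "PiE {..<m} (\<lambda>i. cint (u i) (v i)) \<subseteq> W"
    "\<forall>c d. (\<forall>i<m. u i \<le> c i \<and> c i < d i \<and> d i \<le> v i)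
        \<longrightarrow> (\<exists>a\<in>good B n. \<forall>i<m. c i < a i \<and> a i < d i)"
proof -
  define T where "T B n = {p \<in> W. (\<lambda>i. fst (p i)) \<in> good B n}" for B n
  define F1 where "F1 = (\<lambda>(B, n). DA_pow m closure_of (T B n)) ` (Pow (types \<times> {..<m}) \<times> UNIV)"
  define F2 where "F2 = (\<lambda>(e, i). {p \<in> Z. fst (p i) = e}) ` ((jumps \<union> {0, 1}) \<times> {..<m})"
  have WZ: "W \<subseteq> Z" using openin_subset[OF W(1)] by simp
  have "W \<subseteq> \<Union>(F1 \<union> F2)"
  proof
    fix p assume p: "p \<in> W"
    then have pZ: "p \<in> Z" using WZ by blast
    show "p \<in> \<Union>(F1 \<union> F2)"
    proof (cases "(\<lambda>i. fst (p i)) \<in> G")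
      case True
      then obtain B n where B: "B \<subseteq> types \<times> {..<m}" "(\<lambda>i. fst (p i)) \<in> good B n"
        by (rule good_cover)
      have "p \<in> DA_pow m closure_of (T B n)"
        using B p WZ by (intro closure_of_subset[THEN subsetD]) (auto simp: T_def)
      moreover have "DA_pow m closure_of (T B n) \<in> F1"
        unfolding F1_def using B(1) by (intro image_eqI[of _ _ "(B, n)"]) auto
      ultimately show ?thesis by blast
    next
      case False
      then obtain i where i: "i < m" "\<not> (0 < fst (p i) \<and> fst (p i) < 1 \<and> fst (p i) \<notin> jumps)"
        by (auto simp: G_def)
      have "p i \<in> DA" using pZ i by auto
      then have "fst (p i) \<in> jumps \<union> {0, 1}" using i by (auto simp: DA_def)
      then have "{q \<in> Z. fst (q i) = fst (p i)} \<in> F2"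
        unfolding F2_def using i(1) by (intro image_eqI[of _ _ "(fst (p i), i)"]) auto
      then show ?thesis using pZ by blast
    qed
  qed
  then have "W \<subseteq> DA_pow m interior_of \<Union>(F1 \<union> F2)"
    using W(1) by (rule interior_of_maximal)
  then have "DA_pow m interior_of \<Union>(F1 \<union> F2) \<noteq> {}" using W(2) by blast
  moreover have "countable (F1 \<union> F2)"
    unfolding F1_def F2_def using finite_types countable_jumps
    by (intro countable_Un countable_image countable_SIGMA) (auto intro: countable_finite)
  moreover have "locally_compact_space (DA_pow m) \<and> regular_space (DA_pow m)"
    using compact_DA_pow Hausdorff_DA_pow
    by (simp add: compact_imp_locally_compact_space compact_Hausdorff_imp_regular_space)
  moreover have "closedin (DA_pow m) S" if "S \<in> F1 \<union> F2" for S
    using that closedin_hyperplane by (auto simp: F1_def F2_def)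
  ultimately obtain S where "S \<in> F1 \<union> F2" "DA_pow m interior_of S \<noteq> {}"
    using Baire_category_alt[of "DA_pow m" "F1 \<union> F2"] by metis
  then obtain B n where "DA_pow m interior_of (DA_pow m closure_of (T B n)) \<noteq> {}"
    using interior_hyperplane by (auto simp: F1_def F2_def)
  then obtain p0 where p0: "p0 \<in> DA_pow m interior_of (DA_pow m closure_of (T B n))" by blast
  define Q where "Q = DA_pow m interior_of (DA_pow m closure_of (T B n))"
  have Q: "openin (DA_pow m) Q" "p0 \<in> Q" "Q \<subseteq> DA_pow m closure_of (T B n)"
    unfolding Q_def using p0 by (simp_all add: interior_of_subset)
  then obtain p where "p \<in> Q" "p \<in> T B n" by (metis in_closure_of subsetD)
  then have p: "p \<in> Q \<inter> W" by (auto simp: T_def)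
  have "openin (DA_pow m) (Q \<inter> W)" using Q W by auto
  then obtain e where e: "e > 0" "nbox m p e \<subseteq> Q \<inter> W"
    using openin_DA_pow_nbox p by blast
  have pDA: "p i \<in> DA" if "i < m" for i using p WZ that by auto
  have "\<exists>u v. 0 \<le> u \<and> u < v \<and> v \<le> 1 \<and> v - u \<le> 1 / Suc n \<and> cint u v \<subseteq> nb (p i) e"
    if i: "i < m" for i
  proof -
    obtain u v where "0 \<le> u" "u < v" "v \<le> 1" "v - u \<le> min e (1 / Suc n)"
        "cint u v \<subseteq> nb (p i) (min e (1 / Suc n))"
      using nb_cint[OF pDA[OF i], of "min e (1 / Suc n)"] e(1) by auto
    moreover have "v - u \<le> 1 / Suc n" using calculation(4) by simp
    moreover have "cint u v \<subseteq> nb (p i) e"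
      using calculation(5) nb_mono[of "min e (1 / Suc n)" e "p i"] by (meson min.cobounded1 order_trans)
    ultimately show ?thesis by blast
  qed
  then obtain u v where uv: "\<And>i. i < m \<Longrightarrow> 0 \<le> u i \<and> u i < v i \<and> v i \<le> 1 \<and> v i - u i \<le> 1 / Suc n"
      and cint: "\<And>i. i < m \<Longrightarrow> cint (u i) (v i) \<subseteq> nb (p i) e"
    by metis
  have sub: "PiE {..<m} (\<lambda>i. cint (u i) (v i)) \<subseteq> Q \<inter> W"
    using PiE_mono[of "{..<m}" "\<lambda>i. cint (u i) (v i)" "\<lambda>i. nb (p i) e"] cint e(2)
    unfolding nbox_def by auto
  have dense: "\<exists>a\<in>good B n. \<forall>i<m. c i < a i \<and> a i < d i"
    if cd: "\<And>i. i < m \<Longrightarrow> u i \<le> c i \<and> c i < d i \<and> d i \<le> v i" for c d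
  proof -
    \<comment> \<open>Passing to the middle third leaves room: real parts of points in
      \<open>cint (c' i) (d' i)\<close> may equal its end points, yet stay strictly between
      \<open>c i\<close> and \<open>d i\<close>.\<close>
    define c' where "c' i = (2 * c i + d i) / 3" for i
    define d' where "d' i = (c i + 2 * d i) / 3" for i
    have cd': "c i < c' i \<and> c' i < d' i \<and> d' i < d i" if "i < m" for i
      using cd[OF that] by (auto simp: c'_def d'_def field_simps)
    let ?C = "PiE {..<m} (\<lambda>i. cint (c' i) (d' i))"
    have "((c' i + d' i) / 2, 0) \<in> cint (c' i) (d' i)" if "i < m" for i
      using cd'[OF that] cd[OF that] uv[OF that]
      by (intro mem_cint_interior) (auto simp: DA_iff)
    then have ne: "(\<lambda>i\<in>{..<m}. ((c' i + d' i) / 2, 0)) \<in> ?C" by auto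
    have "?C \<subseteq> PiE {..<m} (\<lambda>i. cint (u i) (v i))"
      using cd cd' by (intro PiE_mono cint_mono) (force simp: less_imp_le)+
    then have "?C \<subseteq> DA_pow m closure_of (T B n)"
      using sub Q(3) by (meson Int_lower1 order_trans)
    then have "(\<lambda>i\<in>{..<m}. ((c' i + d' i) / 2, 0)) \<in> DA_pow m closure_of (T B n)"
      using ne by (rule subsetD)
    moreover have "openin (DA_pow m) ?C" by (intro openin_box openin_cint)
    ultimately obtain q where q: "q \<in> T B n" "q \<in> ?C"
      using ne unfolding in_closure_of by blast
    have "c i < fst (q i) \<and> fst (q i) < d i" if "i < m" for i
    proof -
      have "q i \<in> cint (c' i) (d' i)" using q(2) that by auto
      then show ?thesis using cd'[OF that] by (auto simp: cint_iff lexless_def)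
    qed
    then show ?thesis
      using q(1) by (intro bexI[of _ "\<lambda>i. fst (q i)"]) (auto simp: T_def)
  qed
  show ?thesis
    by (rule that[of u v n B]) (use uv sub dense in auto)
qed

text \<open>The sides of the box are at most \<open>1 / Suc n\<close>, so any two points of
  \<open>D\<close> are close enough for \<open>good_step\<close>. The sign vector then decides the
  order of \<open>hhat\<close>, and \<open>sign_dependence_coordinate\<close> reduces it to a single
  coordinate.\<close>

lemma hhat_monotone_box:
  assumes W: "openin (DA_pow m) W" "W \<noteq> {}"
  obtains D u v \<kappa> e where
    "\<forall>i<m. 0 \<le> u i \<and> u i < v i \<and> v i \<le> 1"
    "PiE {..<m} (\<lambda>i. cint (u i) (v i)) \<subseteq> W" "D \<subseteq> G"
    "\<forall>c d. (\<forall>i<m. u i \<le> c i \<and> c i < d i \<and> d i \<le> v i)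
        \<longrightarrow> (\<exists>a\<in>D. \<forall>i<m. c i < a i \<and> a i < d i)"
    "\<forall>j<m. \<kappa> j < m"
    "\<forall>j<m. \<forall>a\<in>D. \<forall>b\<in>D. a (\<kappa> j) < b (\<kappa> j) \<longrightarrow>
        (if e j then hhat a j < hhat b j else hhat b j < hhat a j)"
proof -
  obtain B n u v where
    uv: "\<forall>i<m. 0 \<le> u i \<and> u i < v i \<and> v i \<le> 1 \<and> v i - u i \<le> 1 / Suc n"
    and sub: "PiE {..<m} (\<lambda>i. cint (u i) (v i)) \<subseteq> W"
    and dense: "\<forall>c d. (\<forall>i<m. u i \<le> c i \<and> c i < d i \<and> d i \<le> v i)
        \<longrightarrow> (\<exists>a\<in>good B n. \<forall>i<m. c i < a i \<and> a i < d i)"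
    by (rule dense_good_box[OF W]) (rule that; assumption)
  define D where "D = {a \<in> good B n. \<forall>i<m. u i < a i \<and> a i < v i}"
  have dense': "\<exists>a\<in>D. \<forall>i<m. c i < a i \<and> a i < d i"
    if cd: "\<And>i. i < m \<Longrightarrow> u i \<le> c i \<and> c i < d i \<and> d i \<le> v i" for c d
  proof -
    obtain a where "a \<in> good B n" "\<forall>i<m. c i < a i \<and> a i < d i" using dense cd by metis
    then show ?thesis using cd by (intro bexI[of _ a]) (force simp: D_def)+
  qed
  have "\<exists>k<m. \<exists>e. \<forall>a\<in>D. \<forall>b\<in>D. a k < b k \<longrightarrow>
      (if e then hhat a j < hhat b j else hhat b j < hhat a j)" if j: "j < m" for j
  proof (rule sign_dependence_coordinate[where P = "\<lambda>s. (s, j) \<in> B" and u = u and v = v])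
    fix a b s
    assume ab: "a \<in> D" "b \<in> D" and s: "s \<in> types"
      and sgn: "\<And>i. i < m \<Longrightarrow> a i \<noteq> b i \<and> (s i = 1 \<longleftrightarrow> a i < b i)"
    have near: "\<bar>a i - b i\<bar> < 1 / Suc n" if "i < m" for i
    proof -
      have "u i < a i" "a i < v i" "u i < b i" "b i < v i"
        using ab that by (auto simp: D_def)
      moreover have "v i - u i \<le> 1 / Suc n" using uv that by blast
      ultimately show ?thesis by linarith
    qed
    show "if (s, j) \<in> B then hhat a j < hhat b j else hhat b j < hhat a j"
      using ab by (intro good_step[OF _ _ s j near sgn]) (auto simp: D_def)
  qed (use uv dense' in \<open>auto simp: D_def\<close>)
  then obtain \<kappa> e where "\<forall>j<m. \<kappa> j < m"
    "\<forall>j<m. \<forall>a\<in>D. \<forall>b\<in>D. a (\<kappa> j) < b (\<kappa> j) \<longrightarrow>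
        (if e j then hhat a j < hhat b j else hhat b j < hhat a j)"
    by metis
  moreover have "D \<subseteq> G" by (auto simp: D_def good_def)
  ultimately show ?thesis
    using that[of u v D \<kappa> e] uv sub dense' by blast
qed

end

subsection \<open>Boxes on which the homeomorphism splits\<close>

text \<open>The flag \<open>e\<close> lets increasing and decreasing maps share one
  argument.\<close>

definition olex :: "bool \<Rightarrow> real \<times> nat \<Rightarrow> real \<times> nat \<Rightarrow> bool" where
  "olex e x y \<longleftrightarrow> (if e then lexless x y else lexless y x)"

lemma olex_separation:
  assumes "x \<in> DA" "y \<in> DA" "olex e x y"
  obtains S T where "openin DA_top S" "openin DA_top T" "x \<in> S" "y \<in> T"
    "\<And>a b. a \<in> S \<Longrightarrow> b \<in> T \<Longrightarrow> olex e a b"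
proof (cases e)
  case True
  then have "lexless x y" using assms(3) by (simp add: olex_def)
  then obtain c where "x \<in> below c" "y \<in> above c" by (rule DA_cut[OF assms(1,2)])
  then show ?thesis using that[of "below c" "above c"] True below_less_above openin_below openin_above
    by (auto simp: olex_def)
next
  case False
  then have "lexless y x" using assms(3) by (simp add: olex_def)
  then obtain c where "y \<in> below c" "x \<in> above c" by (rule DA_cut[OF assms(2,1)])
  then show ?thesis using that[of "above c" "below c"] False below_less_above openin_below openin_above
    by (auto simp: olex_def)
qed

lemma olex_trichotomy: "olex e x y \<or> x = y \<or> olex e y x"
  using lexless_linear[of x y] by (auto simp: olex_def)

lemma olex_fst: "olex e x y \<Longrightarrow> if e then fst x \<le> fst y else fst y \<le> fst x"
  by (auto simp: olex_def lexless_def)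

lemma strictly_monotone_on_olex:
  assumes "\<And>x y. x \<in> I \<Longrightarrow> y \<in> I \<Longrightarrow> lexless x y \<Longrightarrow> olex e (g x) (g y)"
  shows "strictly_monotone_on I g"
  using assms by (cases e) (auto simp: strictly_monotone_on_def olex_def)

text \<open>Collects what is asked of a single box. The last clause expresses \<open>h\<close> as a
  product map followed by a permutation of coordinates.\<close>

definition tame :: "nat \<Rightarrow> ((nat \<Rightarrow> real \<times> nat) \<Rightarrow> nat \<Rightarrow> real \<times> nat) \<Rightarrow> (nat \<Rightarrow> (real \<times> nat) set) \<Rightarrow> bool" where
  "tame m h I \<longleftrightarrow> (\<forall>j<m. clopen_interval (I j)) \<and>
     (\<exists>(g :: nat \<Rightarrow> real \<times> nat \<Rightarrow> real \<times> nat) (\<tau> :: nat \<Rightarrow> nat).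
        bij_betw \<tau> {..<m} {..<m} \<and>
        (\<forall>j<m. \<exists>J. clopen_interval J \<and> strictly_monotone_on (I j) (g j) \<and>
              homeomorphic_map (subtopology DA_top (I j)) (subtopology DA_top J) (g j)) \<and>
        (\<forall>x \<in> PiE {..<m} I. \<forall>j<m. h x (\<tau> j) = g j (x j)))"

lemma clopen_interval_between:
  assumes "clopen_interval S" "x \<in> S" "z \<in> S" "y \<in> DA" "lexless x y" "lexless y z"
  shows "y \<in> S"
proof -
  have "\<forall>x\<in>S. \<forall>z\<in>S. \<forall>y\<in>DA. lexless x y \<and> lexless y z \<longrightarrow> y \<in> S"
    using assms(1) unfolding clopen_interval_def convex_DA_def by (elim conjE)
  then show ?thesis using assms(2-6) by (meson bspec)
qed

text \<open>Continuity makes the preimage clopen; monotonicity makes it convex.\<close>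

lemma clopen_interval_mono_vimage:
  assumes K: "clopen_interval K" and J: "clopen_interval J"
    and cont: "continuous_map (subtopology DA_top K) DA_top g"
    and mono: "\<And>x y. x \<in> K \<Longrightarrow> y \<in> K \<Longrightarrow> lexless x y \<Longrightarrow> olex e (g x) (g y)"
    and ne: "x0 \<in> K" "g x0 \<in> J"
  shows "clopen_interval {x \<in> K. g x \<in> J}"
proof -
  have KDA: "K \<subseteq> DA" using K by (simp add: clopen_interval_def convex_DA_def)
  have eq: "{x \<in> topspace (subtopology DA_top K). g x \<in> J} = {x \<in> K. g x \<in> J}"
    using KDA by auto
  have "openin (subtopology DA_top K) {x \<in> K. g x \<in> J}"
    using openin_continuous_map_preimage[OF cont, of J] J unfolding eq clopen_interval_def by blast
  then have op: "openin DA_top {x \<in> K. g x \<in> J}"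
    using K openin_open_subtopology unfolding clopen_interval_def by blast
  have "closedin (subtopology DA_top K) {x \<in> K. g x \<in> J}"
    using closedin_continuous_map_preimage[OF cont, of J] J unfolding eq clopen_interval_def by blast
  then have cl: "closedin DA_top {x \<in> K. g x \<in> J}"
    using K closedin_closed_subtopology unfolding clopen_interval_def by blast
  have "convex_DA {x \<in> K. g x \<in> J}"
    unfolding convex_DA_def
  proof (intro conjI ballI impI)
    show "{x \<in> K. g x \<in> J} \<subseteq> DA" using KDA by blast
    fix x z y
    assume x: "x \<in> {x \<in> K. g x \<in> J}" and z: "z \<in> {x \<in> K. g x \<in> J}" and y: "y \<in> DA"
      and lt: "lexless x y \<and> lexless y z"
    have yK: "y \<in> K" using clopen_interval_between[OF K, of x z y] x y z lt by simp
    have "olex e (g x) (g y)" "olex e (g y) (g z)" using mono x z yK lt by auto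
    moreover have "g y \<in> DA"
      using continuous_map_image_subset_topspace[OF cont] yK KDA by auto
    ultimately have "g y \<in> J"
      using clopen_interval_between[OF J, of "g x" "g z" "g y"]
        clopen_interval_between[OF J, of "g z" "g x" "g y"] x z
      by (cases e) (simp_all add: olex_def)
    then show "y \<in> {x \<in> K. g x \<in> J}" using yK by blast
  qed
  then show ?thesis unfolding clopen_interval_def using op cl ne by blast
qed

text \<open>The images of the \<open>K j\<close> are not known to be intervals. As \<open>h\<close>
  is open, a box of clopen intervals around \<open>h p0\<close> fits into the image of the box; its
  factors are pulled back along the \<open>g j\<close>.\<close>

lemma ex_tame_box_of_separated:
  fixes K :: "nat \<Rightarrow> (real \<times> nat) set"
  assumes hom: "homeomorphic_map (DA_pow m) (DA_pow m) h"
    and K: "\<And>j. j < m \<Longrightarrow> clopen_interval (K j)"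
    and bij: "bij_betw \<tau> {..<m} {..<m}"
    and eq: "\<And>x j. x \<in> PiE {..<m} K \<Longrightarrow> j < m \<Longrightarrow> h x (\<tau> j) = g j (x j)"
    and cont: "\<And>j. j < m \<Longrightarrow> continuous_map (subtopology DA_top (K j)) DA_top (g j)"
    and mono: "\<And>j x y. j < m \<Longrightarrow> x \<in> K j \<Longrightarrow> y \<in> K j \<Longrightarrow> lexless x y \<Longrightarrow> olex (e j) (g j x) (g j y)"
  obtains I where "tame m h I" "PiE {..<m} I \<subseteq> PiE {..<m} K"
proof -
  let ?U = "PiE {..<m} K"
  have KDA: "K j \<subseteq> DA" if "j < m" for j
    using K[OF that] by (simp add: clopen_interval_def convex_DA_def)
  have "?U \<noteq> {}" using K by (auto simp: PiE_eq_empty_iff clopen_interval_def)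
  then obtain p0 where p0: "p0 \<in> ?U" by blast
  have "openin (DA_pow m) ?U" using K by (intro openin_box) (auto simp: clopen_interval_def)
  then have op: "openin (DA_pow m) (h ` ?U)"
    using hom by (auto simp: homeomorphic_eq_everything_map open_map_def)
  then have hDA: "h p0 i \<in> DA" if "i < m" for i
  proof -
    have "h p0 \<in> PiE {..<m} (\<lambda>_. DA)" using openin_subset[OF op] p0 by auto
    then show ?thesis using that by auto
  qed
  obtain d where d: "d > 0" "nbox m (h p0) d \<subseteq> h ` ?U"
    using openin_DA_pow_nbox[OF op] p0 by blast
  have \<tau>: "\<tau> j < m" if "j < m" for j using bij that by (auto simp: bij_betw_def)
  define J where "J j = nb (h p0 j) d" for j
  have J: "clopen_interval (J j)" if "j < m" for j
    unfolding J_def using hDA[OF that] d(1) by (rule clopen_interval_nb)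
  define I where "I j = {y \<in> K j. g j y \<in> J (\<tau> j)}" for j
  have inI: "p0 j \<in> I j" if "j < m" for j
    using eq[OF p0 that] nb_self[OF hDA[OF \<tau>[OF that]] d(1)] p0 that
    by (auto simp: I_def J_def)
  have I: "clopen_interval (I j)" if "j < m" for j
    unfolding I_def
  proof (rule clopen_interval_mono_vimage[OF K[OF that] J[OF \<tau>[OF that]] cont[OF that]])
    show "olex (e j) (g j x) (g j y)" if "x \<in> K j" "y \<in> K j" "lexless x y" for x y
      using mono[OF \<open>j < m\<close> that] .
    show "p0 j \<in> K j" "g j (p0 j) \<in> J (\<tau> j)" using inI[OF that] by (auto simp: I_def)
  qed
  have inj: "inj_on (g j) (K j)" if "j < m" for j
  proof (rule inj_onI)
    fix x y assume "x \<in> K j" "y \<in> K j" "g j x = g j y"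
    then show "x = y" using mono[OF that, of x y] mono[OF that, of y x] lexless_linear[of x y]
      by (auto simp: olex_def split: if_splits)
  qed
  have im: "g j ` I j = J (\<tau> j)" if "j < m" for j
  proof
    show "J (\<tau> j) \<subseteq> g j ` I j"
    proof
      fix z assume z: "z \<in> J (\<tau> j)"
      have "h p0 \<in> nbox m (h p0) d"
        using hDA d(1) openin_subset[OF op] p0 by (intro nbox_self) auto
      \<comment> \<open>Moving only coordinate \<open>\<tau> j\<close> of \<open>h p0\<close> stays
        in the box, so the result is a value of \<open>h\<close>, and its preimage yields the point
        sent to \<open>z\<close>.\<close>
      then have "(h p0)(\<tau> j := z) \<in> nbox m (h p0) d"
        using z \<tau>[OF that] by (auto simp: nbox_def J_def PiE_iff extensional_def)
      then obtain x where x: "x \<in> ?U" "(h p0)(\<tau> j := z) = h x" using d(2) by blast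
      have "z = g j (x j)" using fun_cong[OF x(2), of "\<tau> j"] eq[OF x(1) that] by simp
      then show "z \<in> g j ` I j" using x(1) that z by (auto simp: I_def)
    qed
  qed (auto simp: I_def)
  have smono: "strictly_monotone_on (I j) (g j)" if "j < m" for j
    using mono[OF that] by (intro strictly_monotone_on_olex[of _ "e j"]) (auto simp: I_def)
  have "homeomorphic_map (subtopology DA_top (I j)) (subtopology DA_top (J (\<tau> j))) (g j)"
    if j: "j < m" for j
  proof (rule continuous_imp_homeomorphic_map)
    have IK: "I j \<subseteq> K j" by (auto simp: I_def)
    have tI: "topspace (subtopology DA_top (I j)) = I j" using IK KDA[OF j] by auto
    have tJ: "topspace (subtopology DA_top (J (\<tau> j))) = J (\<tau> j)"
      using J[OF \<tau>[OF j]] by (auto simp: clopen_interval_def convex_DA_def)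
    show "continuous_map (subtopology DA_top (I j)) (subtopology DA_top (J (\<tau> j))) (g j)"
      using continuous_map_from_subtopology_mono[OF cont[OF j] IK] im[OF j]
      by (auto simp: continuous_map_in_subtopology tI)
    have "compactin DA_top (I j)"
      using I[OF j] closedin_compact_space[OF compact_DA_top] by (auto simp: clopen_interval_def)
    then show "compact_space (subtopology DA_top (I j))" by (rule compact_space_subtopology)
    show "Hausdorff_space (subtopology DA_top (J (\<tau> j)))"
      using Hausdorff_DA_top by (rule Hausdorff_space_subtopology)
    show "g j ` topspace (subtopology DA_top (I j)) = topspace (subtopology DA_top (J (\<tau> j)))"
      using im[OF j] tI tJ by simp
    show "inj_on (g j) (topspace (subtopology DA_top (I j)))"
      using inj_on_subset[OF inj[OF j] IK] tI by simp
  qed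
  then have "\<exists>J. clopen_interval J \<and> strictly_monotone_on (I j) (g j) \<and>
      homeomorphic_map (subtopology DA_top (I j)) (subtopology DA_top J) (g j)" if "j < m" for j
    using smono[OF that] J[OF \<tau>[OF that]] that by blast
  moreover have sub: "PiE {..<m} I \<subseteq> ?U" by (intro PiE_mono) (auto simp: I_def)
  then have "\<forall>x\<in>PiE {..<m} I. \<forall>j<m. h x (\<tau> j) = g j (x j)" using eq sub by (metis subsetD)
  ultimately have "tame m h I"
    unfolding tame_def using I bij by (intro conjI exI[of _ g] exI[of _ \<tau>]) simp_all
  then show ?thesis using sub that by blast
qed

context DA_homeo
begin

text \<open>Continuity carries the monotonicity of \<open>hhat\<close> on \<open>D\<close> over to
  \<open>h\<close> on the whole box, in weak form. So coordinate \<open>j\<close> of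
  \<open>h\<close> depends on coordinate \<open>\<kappa> j\<close> alone, and injectivity of
  \<open>h\<close> gives bijectivity of \<kappa> and strictness.\<close>

lemma ex_tame_box:
  assumes W: "openin (DA_pow m) W" "W \<noteq> {}"
  obtains I where "tame m h I" "PiE {..<m} I \<subseteq> W"
proof -
  obtain D u v \<kappa> e where
    uv: "\<forall>i<m. 0 \<le> u i \<and> u i < v i \<and> v i \<le> 1"
    and UW: "PiE {..<m} (\<lambda>i. cint (u i) (v i)) \<subseteq> W" and DG: "D \<subseteq> G"
    and dense: "\<forall>c d. (\<forall>i<m. u i \<le> c i \<and> c i < d i \<and> d i \<le> v i)
        \<longrightarrow> (\<exists>a\<in>D. \<forall>i<m. c i < a i \<and> a i < d i)"
    and \<kappa>: "\<forall>j<m. \<kappa> j < m"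
    and hat: "\<forall>j<m. \<forall>a\<in>D. \<forall>b\<in>D. a (\<kappa> j) < b (\<kappa> j) \<longrightarrow>
        (if e j then hhat a j < hhat b j else hhat b j < hhat a j)"
    by (rule hhat_monotone_box[OF W]) (rule that; assumption)
  define K where "K i = cint (u i) (v i)" for i
  define U where "U = PiE {..<m} K"
  define z where "z a = pt m a (\<lambda>i\<in>{..<m}. 0)" for a
  have UZ: "U \<subseteq> Z" unfolding U_def K_def using cint_subset_DA by (intro PiE_mono) auto
  \<comment> \<open>Every point of the box is approximated by points over \<open>D\<close> whose
    coordinate \<open>k\<close> lies strictly on the side from which \<open>p k\<close> is
    approached.\<close>
  have approx: "\<exists>a\<in>D. z a \<in> V \<and> (if snd (p k) = 1 then fst (p k) < a k \<and> a k < fst (p k) + d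
        else fst (p k) - d < a k \<and> a k < fst (p k))"
    if p: "p \<in> U" "p \<in> V" and V: "openin (DA_pow m) V" and k: "k < m" and d: "d > 0" for p V k d
  proof -
    obtain d1 where d1: "d1 > 0" "nbox m p d1 \<subseteq> V" using openin_DA_pow_nbox[OF V p(2)] by blast
    define c where "c i = (if snd (p i) = 1 then fst (p i) else max (u i) (fst (p i) - min d d1))" for i
    define c' where "c' i = (if snd (p i) = 1 then min (v i) (fst (p i) + min d d1) else fst (p i))" for i
    have "u i \<le> c i \<and> c i < c' i \<and> c' i \<le> v i" if "i < m" for i
    proof -
      have "p i \<in> cint (u i) (v i)"
        using PiE_mem[of p "{..<m}" K i] p(1) that by (simp add: U_def K_def)
      then show ?thesis using d d1(1) by (cases "p i") (auto simp: c_def c'_def cint_iff DA_iff)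
    qed
    then obtain a where a: "a \<in> D" "\<forall>i<m. c i < a i \<and> a i < c' i" using dense by blast
    have "(a i, 0) \<in> nb (p i) d1" if "i < m" for i
    proof -
      have "(a i, 0) \<in> DA" using G_DA a(1) DG that by blast
      then show ?thesis using a(2) that
        by (auto simp: nb_def c_def c'_def intro!: mem_cint_interior split: if_splits)
    qed
    then have "z a \<in> nbox m p d1" by (auto simp: z_def pt_def nbox_def)
    moreover have "if snd (p k) = 1 then fst (p k) < a k \<and> a k < fst (p k) + d
        else fst (p k) - d < a k \<and> a k < fst (p k)"
      using a(2) k by (auto simp: c_def c'_def split: if_splits)
    ultimately show ?thesis using a(1) d1(2) by blast
  qed
  have mono: "\<not> olex (e j) (h q j) (h p j)"
    if j: "j < m" and pq: "p \<in> U" "q \<in> U" and le: "\<not> lexless (q (\<kappa> j)) (p (\<kappa> j))" for j p q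
  proof
    assume o: "olex (e j) (h q j) (h p j)"
    let ?k = "\<kappa> j"
    have k: "?k < m" using \<kappa> j by blast
    have pqZ: "p \<in> Z" "q \<in> Z" using pq UZ by auto
    obtain S T where ST: "openin DA_top S" "openin DA_top T" "h q j \<in> S" "h p j \<in> T"
      "\<And>x y. x \<in> S \<Longrightarrow> y \<in> T \<Longrightarrow> olex (e j) x y"
      using olex_separation[OF _ _ o] h_comp_in pqZ j by metis
    define V where "V S = {r \<in> Z. h r j \<in> S}" for S
    have V: "openin (DA_pow m) (V S)" "openin (DA_pow m) (V T)" "q \<in> V S" "p \<in> V T"
      using openin_h_vimage j ST pqZ by (auto simp: V_def)
    have contra: False if ab: "a \<in> D" "b \<in> D" "z a \<in> V T" "z b \<in> V S" "a ?k < b ?k" for a b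
    proof -
      have "olex (e j) (h (z b) j) (h (z a) j)" using ab ST(5) by (auto simp: V_def)
      then have "if e j then hhat b j \<le> hhat a j else hhat a j \<le> hhat b j"
        using olex_fst by (auto simp: hhat_def z_def)
      moreover have "if e j then hhat a j < hhat b j else hhat b j < hhat a j"
        using hat j ab by blast
      ultimately show False by (auto split: if_splits)
    qed
    note apq = approx[OF pq(1) V(4,2) k] approx[OF pq(2) V(3,1) k]
    \<comment> \<open>In each case approximants with \<open>a ?k < b ?k\<close> are needed. If
      \<open>p\<close> and \<open>q\<close> agree at \<open>?k\<close>, both are approached from the
      same side, so the outer approximant is chosen first and the other one closer.\<close>
    consider "p ?k = q ?k" "snd (p ?k) = 1" | "p ?k = q ?k" "snd (p ?k) \<noteq> 1"
      | "fst (p ?k) = fst (q ?k)" "snd (p ?k) < snd (q ?k)" | "fst (p ?k) < fst (q ?k)"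
      using le by (auto simp: lexless_def prod_eq_iff not_less) linarith+
    then show False
    proof cases
      case 1
      then obtain b where b: "b \<in> D" "z b \<in> V S" "fst (p ?k) < b ?k"
        using apq(2)[of 1] by auto
      then obtain a where "a \<in> D" "z a \<in> V T" "a ?k < b ?k"
        using apq(1)[of "b ?k - fst (p ?k)"] 1 by auto
      then show False using contra b by blast
    next
      case 2
      then obtain a where a: "a \<in> D" "z a \<in> V T" "a ?k < fst (p ?k)"
        using apq(1)[of 1] by auto
      then obtain b where "b \<in> D" "z b \<in> V S" "a ?k < b ?k"
        using apq(2)[of "fst (p ?k) - a ?k"] 2 by auto
      then show False using contra a by blast
    next
      case 3
      have "p ?k \<in> DA" "q ?k \<in> DA" using pqZ k by auto
      then have s: "snd (p ?k) = 0" "snd (q ?k) = 1" using 3 by (auto simp: DA_def)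
      obtain a where a: "a \<in> D" "z a \<in> V T" "a ?k < fst (p ?k)"
        using apq(1)[of 1] s by auto
      obtain b where b: "b \<in> D" "z b \<in> V S" "fst (q ?k) < b ?k"
        using apq(2)[of 1] s by auto
      show False using contra[OF a(1) b(1) a(2) b(2)] a(3) b(3) 3 by linarith
    next
      case 4
      define d where "d = (fst (q ?k) - fst (p ?k)) / 2"
      have d: "d > 0" "fst (p ?k) + d = fst (q ?k) - d" using 4 by (auto simp: d_def field_simps)
      obtain a where a: "a \<in> D" "z a \<in> V T" "a ?k < fst (p ?k) + d"
        using apq(1)[OF d(1)] d(1) by (auto split: if_splits)
      obtain b where b: "b \<in> D" "z b \<in> V S" "fst (q ?k) - d < b ?k"
        using apq(2)[OF d(1)] d(1) by (auto split: if_splits)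
      show False using contra[OF a(1) b(1) a(2) b(2)] a(3) b(3) d by linarith
    qed
  qed
  have dep: "h p j = h q j" if "j < m" "p \<in> U" "q \<in> U" "p (\<kappa> j) = q (\<kappa> j)" for j p q
    using mono[of j p q] mono[of j q p] olex_trichotomy[of "e j" "h p j" "h q j"] that by auto
  have upd: "p(k := y) \<in> U" if "p \<in> U" "k < m" "y \<in> K k" for p k y
    using that by (auto simp: U_def PiE_iff extensional_def)
  have K: "\<exists>w1\<in>K k. \<exists>w2\<in>K k. w1 \<noteq> w2" if "k < m" for k
  proof -
    have "0 \<le> u k" "u k < v k" "v k \<le> 1" using uv that by auto
    then have "((2 * u k + v k) / 3, 0) \<in> K k" "((u k + 2 * v k) / 3, 0) \<in> K k"
      unfolding K_def by (auto intro!: mem_cint_interior simp: DA_iff)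
    moreover have "((2 * u k + v k) / 3, 0::nat) \<noteq> ((u k + 2 * v k) / 3, 0)"
      using uv that by auto
    ultimately show ?thesis by blast
  qed
  then have "U \<noteq> {}" unfolding U_def PiE_eq_empty_iff by blast
  then obtain p0 where p0: "p0 \<in> U" by blast
  have h_ext: "p = q" if "p \<in> U" "q \<in> U" "\<And>j. j < m \<Longrightarrow> h p j = h q j" for p q
  proof -
    have "h p = h q" using that h_in UZ by (intro PiE_ext[of _ "{..<m}" "\<lambda>_. DA"]) auto
    then show ?thesis using h_inj UZ that by (meson inj_onD subsetD)
  qed
  \<comment> \<open>Otherwise changing coordinate \<open>k\<close> of \<open>p0\<close> would not
    affect \<open>h\<close>.\<close>
  have "k \<in> \<kappa> ` {..<m}" if k: "k < m" for k
  proof (rule ccontr)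
    assume nk: "k \<notin> \<kappa> ` {..<m}"
    obtain w where w: "w \<in> K k" "w \<noteq> p0 k" using K[OF k] by metis
    have "h (p0(k := w)) j = h p0 j" if "j < m" for j
      using nk that k w by (intro dep upd p0) auto
    then have "p0(k := w) = p0" using upd p0 k w by (intro h_ext) auto
    then show False using w(2) by (metis fun_upd_same)
  qed
  then have surj: "\<kappa> ` {..<m} = {..<m}" using \<kappa> by auto
  then have "bij_betw \<kappa> {..<m} {..<m}"
    by (simp add: bij_betw_def eq_card_imp_inj_on)
  define \<tau> where "\<tau> = inv_into {..<m} \<kappa>"
  have \<tau>: "bij_betw \<tau> {..<m} {..<m}"
    unfolding \<tau>_def using \<open>bij_betw \<kappa> {..<m} {..<m}\<close> by (rule bij_betw_inv_into)
  have \<kappa>\<tau>: "\<kappa> (\<tau> j) = j" "\<tau> j < m" if "j < m" for j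
    using that surj \<tau> unfolding \<tau>_def by (auto simp: f_inv_into_f bij_betw_def)
  have \<kappa>_inj: "\<kappa> l = j \<Longrightarrow> l = \<tau> j" if "l < m" for l j
    using that \<open>bij_betw \<kappa> {..<m} {..<m}\<close> by (auto simp: \<tau>_def bij_betw_def)
  \<comment> \<open>The remaining coordinates are frozen at \<open>p0\<close>; by \<open>dep\<close>
    their values do not matter.\<close>
  define g where "g j y = h (p0(j := y)) (\<tau> j)" for j y
  have eq: "h x (\<tau> j) = g j (x j)" if "x \<in> U" "j < m" for x j
  proof -
    have "x j \<in> K j" using that by (auto simp: U_def)
    then show ?thesis unfolding g_def using that \<kappa>\<tau>[OF that(2)] by (intro dep upd p0) auto
  qed
  have g_inj: "y = y'" if j: "j < m" and y: "y \<in> K j" "y' \<in> K j" and g: "g j y = g j y'" for j y y'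
  proof -
    have "h (p0(j := y)) l = h (p0(j := y')) l" if l: "l < m" for l
    proof (cases "l = \<tau> j")
      case True
      then show ?thesis using g by (simp add: g_def)
    next
      case False
      then show ?thesis using \<kappa>_inj[OF l] l j y by (intro dep upd p0) auto
    qed
    then have "p0(j := y) = p0(j := y')" using upd p0 j y by (intro h_ext) auto
    then show ?thesis by (metis fun_upd_same)
  qed
  have g_mono: "olex (e (\<tau> j)) (g j x) (g j y)"
    if j: "j < m" and xy: "x \<in> K j" "y \<in> K j" and lt: "lexless x y" for j x y
  proof -
    have "\<not> olex (e (\<tau> j)) (h (p0(j := y)) (\<tau> j)) (h (p0(j := x)) (\<tau> j))"
      using \<kappa>\<tau>[OF j] lexless_asym[OF lt] xy j p0 by (intro mono upd) auto
    moreover have "g j x \<noteq> g j y" using g_inj[OF j xy] lt by auto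
    ultimately show ?thesis using olex_trichotomy by (metis g_def)
  qed
  have g_cont: "continuous_map (subtopology DA_top (K j)) DA_top (g j)" if j: "j < m" for j
  proof -
    have KDA: "K j \<subseteq> DA" by (simp add: K_def cint_subset_DA)
    have "continuous_map (subtopology DA_top (K j)) (DA_pow m) (\<lambda>y. p0(j := y))"
      unfolding DA_pow_def
    proof (rule continuous_map_coordinatewise_then_product)
      show "continuous_map (subtopology DA_top (K j)) DA_top (\<lambda>y. (p0(j := y)) i)"
        if "i \<in> {..<m}" for i
        using p0 UZ that by (cases "i = j") auto
      show "(p0(j := y)) i = undefined" if "i \<notin> {..<m}" for i y
        using p0 that j by (auto simp: U_def PiE_iff extensional_def)
    qed
    then have "continuous_map (subtopology DA_top (K j)) DA_top ((\<lambda>p. h p (\<tau> j)) \<circ> (\<lambda>y. p0(j := y)))"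
      using h_comp_cont[OF \<kappa>\<tau>(2)[OF j]] by (rule continuous_map_compose)
    then show ?thesis by (simp add: g_def[abs_def] o_def)
  qed
  have Kc: "clopen_interval (K j)" if "j < m" for j
    using K[OF that] unfolding K_def by (intro clopen_interval_cint) blast
  obtain I where "tame m h I" "PiE {..<m} I \<subseteq> PiE {..<m} K"
    using ex_tame_box_of_separated[OF hom Kc \<tau> eq[unfolded U_def] g_cont g_mono] by blast
  then show ?thesis using that UW unfolding K_def by blast
qed

end

section \<open>A dense disjoint sequence of boxes\<close>

lemma tame_box:
  assumes "tame m h I"
  shows "openin (DA_pow m) (PiE {..<m} I)" "closedin (DA_pow m) (PiE {..<m} I)" "PiE {..<m} I \<noteq> {}"
  using assms unfolding tame_def
  by (auto simp: clopen_interval_def PiE_eq_empty_iff intro!: openin_box closedin_box)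

text \<open>Boxes with rational end points, enumerated through codes of lists. A list that is too
  short gives unspecified end points, but still an open box.\<close>

definition qbox :: "nat \<Rightarrow> nat \<Rightarrow> (nat \<Rightarrow> real \<times> nat) set" where
  "qbox m n = (let q = from_nat n :: (rat \<times> rat) list in
     PiE {..<m} (\<lambda>i. cint (of_rat (fst (q ! i))) (of_rat (snd (q ! i)))))"

lemma openin_qbox: "openin (DA_pow m) (qbox m n)"
  unfolding qbox_def Let_def by (intro openin_box openin_cint)

text \<open>The rational box need not contain \<open>x\<close>: this is a \<pi>-base property, which
  suffices for density.\<close>

lemma ex_qbox_subset:
  assumes "openin (DA_pow m) T" "x \<in> T"
  obtains n where "qbox m n \<noteq> {}" "qbox m n \<subseteq> T"
proof -
  obtain d where d: "d > 0" "nbox m x d \<subseteq> T" using openin_DA_pow_nbox[OF assms] by blast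
  have "\<exists>a b. cint (of_rat a) (of_rat b) \<noteq> {} \<and> cint (of_rat a) (of_rat b) \<subseteq> nb (x i) d" if "i < m" for i
  proof -
    have "x i \<in> DA" using openin_subset[OF assms(1)] assms(2) that by auto
    then obtain u v where uv: "0 \<le> u" "u < v" "v \<le> 1" "cint u v \<subseteq> nb (x i) d"
      using nb_cint d(1) by metis
    obtain b where b: "u < of_rat b" "of_rat b < v" using of_rat_dense uv(2) by blast
    obtain a where a: "u < of_rat a" "of_rat a < (of_rat b :: real)" using of_rat_dense b(1) by blast
    have "((of_rat a + of_rat b) / 2, 0) \<in> cint (of_rat a) (of_rat b)"
      using a b uv by (intro mem_cint_interior) (auto simp: DA_iff)
    moreover have "cint (of_rat a) (of_rat b) \<subseteq> cint u v" using a b by (intro cint_mono) auto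
    ultimately show ?thesis using uv(4) by blast
  qed
  then obtain a b where ab: "\<And>i. i < m \<Longrightarrow> cint (of_rat (a i)) (of_rat (b i)) \<noteq> {}"
      "\<And>i. i < m \<Longrightarrow> cint (of_rat (a i)) (of_rat (b i)) \<subseteq> nb (x i) d"
    by metis
  define n where "n = to_nat (map (\<lambda>i. (a i, b i)) [0..<m])"
  have n: "qbox m n = PiE {..<m} (\<lambda>i. cint (of_rat (a i)) (of_rat (b i)))"
    unfolding qbox_def n_def Let_def by (intro PiE_cong) simp
  have "qbox m n \<noteq> {}" unfolding n using ab(1) by (auto simp: PiE_eq_empty_iff)
  moreover have "qbox m n \<subseteq> nbox m x d" unfolding n nbox_def using ab(2) by (intro PiE_mono) auto
  ultimately show ?thesis using that d(2) by blast
qed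

text \<open>The point \<open>z\<close> is never covered, so that there is room for infinitely many boxes.\<close>

lemma (in DA_homeo) ex_tame_sequence:
  obtains I :: "nat \<Rightarrow> nat \<Rightarrow> (real \<times> nat) set" where "\<forall>n. tame m h (I n)"
    "\<forall>n k. n \<noteq> k \<longrightarrow> PiE {..<m} (I n) \<inter> PiE {..<m} (I k) = {}"
    "(DA_pow m) closure_of (\<Union>n. PiE {..<m} (I n)) = topspace (DA_pow m)"
proof -
  define z :: "nat \<Rightarrow> real \<times> nat" where "z = (\<lambda>i\<in>{..<m}. (0, 1))"
  have z: "z \<in> Z" by (auto simp: z_def DA_iff)
  have cz: "closedin (DA_pow m) {z}"
    using closedin_Hausdorff_singleton[OF Hausdorff_DA_pow, of z] z by simp
  \<comment> \<open>A nonempty open set inside \<open>{z}\<close> would lie in a hyperplane;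
    coordinate \<open>0\<close> exists because \<open>m \<ge> 1\<close>.\<close>
  have nonisolated: "\<exists>y\<in>T. y \<noteq> z" if T: "openin (DA_pow m) T" "T \<noteq> {}" for T
  proof (rule ccontr)
    assume "\<not> ?thesis"
    then have "T \<subseteq> {p \<in> Z. fst (p 0) = fst (z 0)}" using z by auto
    then have "T \<subseteq> DA_pow m interior_of {p \<in> Z. fst (p 0) = fst (z 0)}"
      using T(1) by (rule interior_of_maximal)
    also have "\<dots> = {}" using m_pos by (intro interior_hyperplane) simp
    finally show False using T(2) by simp
  qed
  \<comment> \<open>A state consists of the current box and the closed union of all boxes so far;
    the clause for \<open>n = 0\<close> starts that union.\<close>
  define P where "P n s \<longleftrightarrow> tame m h (fst s) \<and> closedin (DA_pow m) (snd s) \<and> z \<notin> snd s \<and>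
      PiE {..<m} (fst s) \<subseteq> snd s \<and> (n = 0 \<longrightarrow> snd s = PiE {..<m} (fst s))"
    for n :: nat and s :: "(nat \<Rightarrow> (real \<times> nat) set) \<times> (nat \<Rightarrow> real \<times> nat) set"
  define Q where "Q n s t \<longleftrightarrow> PiE {..<m} (fst t) \<inter> snd s = {} \<and> snd t = snd s \<union> PiE {..<m} (fst t) \<and>
      (PiE {..<m} (fst t) \<subseteq> qbox m n \<or> qbox m n \<subseteq> snd s \<union> {z})"
    for n :: nat and s t :: "(nat \<Rightarrow> (real \<times> nat) set) \<times> (nat \<Rightarrow> real \<times> nat) set"
  have "\<exists>f. \<forall>n. P n (f n) \<and> Q n (f n) (f (Suc n))"
  proof (rule dependent_nat_choice)
    have "openin (DA_pow m) (Z - {z})"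
      using openin_diff[OF openin_topspace cz] by simp
    moreover have "Z - {z} \<noteq> {}"
      using nonisolated[OF openin_topspace] z by auto
    ultimately obtain I where "tame m h I" "PiE {..<m} I \<subseteq> Z - {z}" by (rule ex_tame_box)
    then show "\<exists>s. P 0 s"
      using tame_box by (intro exI[of _ "(I, PiE {..<m} I)"]) (auto simp: P_def)
  next
    fix s n assume P: "P n s"
    \<comment> \<open>If \<open>qbox m n\<close> is already covered up to \<open>z\<close>, the next
      box may lie anywhere in the uncovered part, which is open and contains more than
      \<open>z\<close>.\<close>
    define W where "W = (if qbox m n \<subseteq> snd s \<union> {z} then Z else qbox m n) - snd s - {z}"
    have "openin (DA_pow m) (if qbox m n \<subseteq> snd s \<union> {z} then Z else qbox m n)"
      using openin_qbox openin_topspace[of "DA_pow m"] by simp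
    then have oW: "openin (DA_pow m) W"
      unfolding W_def using P cz by (intro openin_diff) (auto simp: P_def)
    have "openin (DA_pow m) (Z - snd s)"
      using openin_diff[OF openin_topspace, of "DA_pow m" "snd s"] P by (auto simp: P_def)
    moreover have "Z - snd s \<noteq> {}" using z P by (auto simp: P_def)
    ultimately have "\<exists>y\<in>Z - snd s. y \<noteq> z" by (rule nonisolated)
    then have "W \<noteq> {}" by (auto simp: W_def)
    then obtain I where I: "tame m h I" "PiE {..<m} I \<subseteq> W" using ex_tame_box[OF oW] by blast
    define t where "t = (I, snd s \<union> PiE {..<m} I)"
    have "P (Suc n) t"
      using P I tame_box[OF I(1)] by (auto simp: P_def t_def W_def split: if_splits)
    moreover have "Q n s t"
      using I(2) by (auto simp: Q_def t_def W_def split: if_splits)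
    ultimately show "\<exists>t. P (Suc n) t \<and> Q n s t" by blast
  qed
  then obtain f where P: "\<And>n. P n (f n)" and Q: "\<And>n. Q n (f n) (f (Suc n))" by blast
  define I where "I n = fst (f n)" for n
  define F where "F n = snd (f n)" for n
  have F_Suc: "F (Suc n) = F n \<union> PiE {..<m} (I (Suc n))" for n
    using Q[of n] by (simp add: Q_def F_def I_def)
  have F_mono: "F n \<subseteq> F k" if "n \<le> k" for n k
    using _ that by (rule lift_Suc_mono_le) (simp add: F_Suc)
  have IF: "PiE {..<m} (I n) \<subseteq> F n" for n using P[of n] by (simp add: P_def F_def I_def)
  have F_Un: "F n \<subseteq> (\<Union>n. PiE {..<m} (I n))" for n
  proof (induction n)
    case 0
    show ?case using P[of 0] by (auto simp: P_def F_def I_def)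
  qed (auto simp: F_Suc)
  have disj: "PiE {..<m} (I n) \<inter> PiE {..<m} (I k) = {}" if nk: "n < k" for n k
  proof -
    obtain k' where k': "k = Suc k'" "n \<le> k'" using nk by (cases k) auto
    have "PiE {..<m} (I k) \<inter> F k' = {}" using Q[of k'] by (simp add: Q_def F_def I_def k')
    then show ?thesis using IF[of n] F_mono[OF k'(2)] by blast
  qed
  have t: "tame m h (I n)" for n using P[of n] by (simp add: P_def I_def)
  have "x \<in> (DA_pow m) closure_of (\<Union>n. PiE {..<m} (I n))" if x: "x \<in> topspace (DA_pow m)" for x
    unfolding in_closure_of
  proof (intro conjI x allI impI)
    fix T assume T: "x \<in> T \<and> openin (DA_pow m) T"
    then obtain n where n: "qbox m n \<noteq> {}" "qbox m n \<subseteq> T" using ex_qbox_subset by blast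
    \<comment> \<open>The box with index \<open>Suc n\<close> is the one chosen to deal with
      \<open>qbox m n\<close>.\<close>
    consider "PiE {..<m} (I (Suc n)) \<subseteq> qbox m n" | "qbox m n \<subseteq> F n \<union> {z}"
      using Q[of n] by (auto simp: Q_def F_def I_def)
    then show "\<exists>y. y \<in> (\<Union>n. PiE {..<m} (I n)) \<and> y \<in> T"
    proof cases
      case 1
      then show ?thesis using n(2) tame_box(3)[OF t, of "Suc n"] by blast
    next
      case 2
      obtain y where y: "y \<in> qbox m n" "y \<noteq> z" using nonisolated[OF openin_qbox n(1)] by (elim bexE)
      then have "y \<in> F n" using 2 by auto
      then have "y \<in> (\<Union>n. PiE {..<m} (I n))" using F_Un by (rule subsetD[rotated])
      then show ?thesis using subsetD[OF n(2) y(1)] by (intro exI[of _ y] conjI)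
    qed
  qed
  then have "(DA_pow m) closure_of (\<Union>n. PiE {..<m} (I n)) = topspace (DA_pow m)"
    by (intro equalityI closure_of_subset_topspace subsetI)
  moreover have "PiE {..<m} (I n) \<inter> PiE {..<m} (I k) = {}" if "n \<noteq> k" for n k
    using disj[of n k] disj[of k n] that by (auto simp: neq_iff)
  ultimately show ?thesis using t by (intro that[of I] allI impI)
qed

theorem theorem1p3:
  fixes m :: nat and h :: "(nat \<Rightarrow> real \<times> nat) \<Rightarrow> (nat \<Rightarrow> real \<times> nat)"
  assumes "m \<ge> 1"
    and "homeomorphic_map (DA_pow m) (DA_pow m) h"
  shows "\<exists>I :: nat \<Rightarrow> nat \<Rightarrow> (real \<times> nat) set.
    (\<forall>n. \<forall>j<m. clopen_interval (I n j)) \<and>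
    (\<forall>n k. n \<noteq> k \<longrightarrow> PiE {..<m} (I n) \<inter> PiE {..<m} (I k) = {}) \<and>
    (DA_pow m) closure_of (\<Union>n. PiE {..<m} (I n)) = topspace (DA_pow m) \<and>
    (\<forall>n. \<exists>(g :: nat \<Rightarrow> real \<times> nat \<Rightarrow> real \<times> nat) (\<tau> :: nat \<Rightarrow> nat).
        bij_betw \<tau> {..<m} {..<m} \<and>
        (\<forall>j<m. \<exists>J. clopen_interval J \<and> strictly_monotone_on (I n j) (g j) \<and>
              homeomorphic_map (subtopology DA_top (I n j)) (subtopology DA_top J) (g j)) \<and>
        (\<forall>x \<in> PiE {..<m} (I n). \<forall>j<m. h x (\<tau> j) = g j (x j)))"
proof -
  interpret DA_homeo m h using assms by unfold_locales
  obtain I :: "nat \<Rightarrow> nat \<Rightarrow> (real \<times> nat) set" where "\<forall>n. tame m h (I n)"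
    "\<forall>n k. n \<noteq> k \<longrightarrow> PiE {..<m} (I n) \<inter> PiE {..<m} (I k) = {}"
    "(DA_pow m) closure_of (\<Union>n. PiE {..<m} (I n)) = topspace (DA_pow m)"
    by (rule ex_tame_sequence) (rule that; assumption)
  then show ?thesis
    unfolding tame_def by (intro exI[of _ I] conjI) simp_all
qed

end
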